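(* Let $k\ge2$ be an integer and suppose $\exp\left(\frac{\log q}{\log\log q}\right)\le x<q^{1/k}$. Then there exists a non-principal character $\chi \pmod q$ for which $$\frac{1}{\sqrt{x}}\left|\sum_{n\le x}\chi(n)\right|\gg_k(\log q)^{\frac{(k-1)^2}{2k}+o(1)}.$$
   Context: $\chi$ is a Dirichlet character modulo $q$; $o(1)$ refers to $q\to\infty$, and the implied constant depends only on $k$. *)

theory Defs
  imports Complex_Main
begin

text \<open>
  A Dirichlet character modulo \<open>q\<close> is represented by its values on the natural numbers;
  by periodicity these determine its values on all integers.
\<close>

definition dirichlet_character :: "nat \<Rightarrow> (nat \<Rightarrow> complex) \<Rightarrow> bool" where
  "dirichlet_character q \<chi> \<longleftrightarrow>
     \<chi> 1 = 1 \<and>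
     (\<forall>m n. \<chi> (m * n) = \<chi> m * \<chi> n) \<and>
     (\<forall>n. \<chi> (n + q) = \<chi> n) \<and>
     (\<forall>n. \<chi> n = 0 \<longleftrightarrow> \<not> coprime n q)"

definition principal_character :: "nat \<Rightarrow> nat \<Rightarrow> complex" where
  "principal_character q n = (if coprime n q then 1 else 0)"

end

theory Submission
  imports Defs
    "HOL-Number_Theory.Number_Theory"
    "HOL-Computational_Algebra.Squarefree"
    "HOL-Real_Asymp.Real_Asymp"
begin

text \<open>
  Write \<open>S(\<chi>)\<close> for the character sum. As \<open>x\<^sup>k < q\<close>, orthogonality turns the mean of \<open>\<bar>S(\<chi>)\<bar>\<^bsup>2k\<^esup>\<close> into
  \<open>\<Sum>r(N)\<^sup>2\<close>, where \<open>r(N)\<close> counts the factorisations of \<open>N\<close> into \<open>k\<close> factors that are at most \<open>x\<close> and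
  coprime to \<open>q\<close>. By Cauchy--Schwarz this is at least \<open>(\<Sum>r(N) b(N))\<^sup>2 / \<Sum>b(N)\<^sup>2\<close> for the completely
  multiplicative weight \<open>b(N) = k\<^bsup>\<Omega>(N)\<^esup>\<close>, restricted to \<open>N\<close> without prime factors below a constant.
  The numerator is the \<open>2k\<close>-th power of \<open>\<Sum>b(n) \<ge> x (ln x)\<^bsup>k-1-o(1)\<^esup>\<close> over \<open>n \<le> x\<close>, and the denominator,
  over \<open>N \<le> x\<^sup>k\<close>, is \<open>O(x\<^sup>k (ln x)\<^bsup>k^2-1\<^esup>)\<close>, which gives \<open>x\<^sup>k (ln x)\<^bsup>(k-1)^2-o(1)\<^esup>\<close>. The principal character
  contributes only \<open>x\<^bsup>2k\<^esup>/\<phi>(q) \<le> x\<^sup>k q/\<phi>(q)\<close>. The loss from coprimality to \<open>q\<close> is a power of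
  \<open>\<phi>(q)/q\<close>, which is at least a power of \<open>1 / ln (ln q)\<close> by a Chebyshev type bound.
\<close>

section \<open>Characters of finite abelian groups\<close>

text \<open>On squarefree \<open>N\<close> the weight \<open>k ^ Omega N\<close> is the number of
  ordered factorisations into \<open>k\<close> factors, so it models \<open>r\<close>. Unlike a
  divisor function it is completely multiplicative, and pairing it with \<open>r\<close> gives an
  exact \<open>k\<close>-th power of a sum over one variable. The price is paid in the squared
  weight, whose Euler factors \<open>1 / (1 - k^2 / p)\<close> break down for
  \<open>p \<le> k^2\<close>; removing the small primes costs only a constant factor. The lower
  bound on \<open>x\<close> is used twice. Sifting by the primes of \<open>q\<close> in the
  elementary way leaves an error exponential in their number, which can have order
  \<open>ln q / ln (ln q)\<close>, so \<open>x\<close> must be exponentially large in that quantity.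
  It also gives \<open>ln x \<ge> ln q / ln (ln q)\<close>, so \<open>ln x\<close> may be replaced
  by \<open>ln q\<close>. Every loss is then a constant or a power of \<open>ln (ln q)\<close>,
  which is why crude constants suffice throughout. The estimates hold only for large
  \<open>q\<close>, while the statement covers every \<open>q \<ge> 3\<close>; the finitely many
  remaining moduli need a separate lower bound and a suitable value of the o(1) term.\<close>

context comm_group
begin

definition char_on :: "'a set \<Rightarrow> ('a \<Rightarrow> complex) \<Rightarrow> bool" where
  "char_on H \<chi> \<longleftrightarrow> \<chi> \<one> = 1 \<and> (\<forall>x\<in>H. \<forall>y\<in>H. \<chi> (x \<otimes> y) = \<chi> x * \<chi> y)"

lemma char_on_mult: "char_on H \<chi> \<Longrightarrow> x \<in> H \<Longrightarrow> y \<in> H \<Longrightarrow> \<chi> (x \<otimes> y) = \<chi> x * \<chi> y"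
  by (simp add: char_on_def)

lemma char_on_one: "char_on H \<chi> \<Longrightarrow> \<chi> \<one> = 1"
  by (simp add: char_on_def)

lemma char_on_pow:
  assumes "char_on (carrier G) \<chi>" "x \<in> carrier G"
  shows "\<chi> (x [^] (n::nat)) = \<chi> x ^ n"
  using assms by (induction n) (simp_all add: char_on_one char_on_mult)

section \<open>Extending characters from subgroups\<close>

lemma subgroup_adjoin:
  assumes "finite (carrier G)" "subgroup H G" "g \<in> carrier G"
  shows "subgroup {h \<otimes> g [^] n |h n::nat. h \<in> H} G" (is "subgroup ?K G")
proof
  have HG: "\<And>h. h \<in> H \<Longrightarrow> h \<in> carrier G" using subgroup.subset[OF assms(2)] by blast
  show "?K \<subseteq> carrier G" using HG assms(3) by auto
  show "x \<otimes> y \<in> ?K" if "x \<in> ?K" "y \<in> ?K" for x y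
  proof -
    from that obtain h n h' n' where *: "x = h \<otimes> g [^] (n::nat)" "h \<in> H"
      "y = h' \<otimes> g [^] (n'::nat)" "h' \<in> H" by auto
    have "x \<otimes> y = (h \<otimes> h') \<otimes> g [^] (n + n')"
      using * HG assms(3) by (simp add: nat_pow_mult [symmetric] m_ac)
    then show ?thesis using * assms(2) by (auto intro: subgroup.m_closed)
  qed
  have "\<one> = \<one> \<otimes> g [^] (0::nat)" by simp
  then show "\<one> \<in> ?K" using subgroup.one_closed[OF assms(2)] by blast
  show "inv x \<in> ?K" if "x \<in> ?K" for x
  proof -
    from that obtain h n where *: "x = h \<otimes> g [^] (n::nat)" "h \<in> H" by auto
    have pos: "order G > 0" using assms(1) by (simp add: order_gt_0_iff_finite)
    \<comment> \<open>Only natural exponents are used, so the inverse of \<open>g [^] n\<close> has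
      to be found among the positive powers, using \<open>g [^] order G = \<one>\<close>.\<close>
    have "g [^] (n * (order G - 1)) \<otimes> g [^] n = (g [^] order G) [^] n"
    proof -
      have "n * (order G - 1) + n = order G * n" using pos by (cases "order G") auto
      then show ?thesis using assms(3) by (simp add: nat_pow_mult nat_pow_pow)
    qed
    then have 1: "g [^] (n * (order G - 1)) \<otimes> g [^] n = \<one>"
      using pow_order_eq_1[OF assms(3)] by simp
    have "inv (g [^] n) = g [^] (n * (order G - 1))"
      using 1 assms(3) by (intro inv_equality) auto
    then have "inv x = inv h \<otimes> g [^] (n * (order G - 1))"
      using * HG assms(3) by (simp add: inv_mult)
    then show ?thesis using * assms(2) by (auto intro: subgroup.m_inv_closed)
  qed
qed

text \<open>Two representations of one element differ by a power of \<open>g\<close> lying in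
  \<open>H\<close>, so the compatibility condition on \<open>w\<close> is exactly what makes the
  value \<open>\<chi> h * w ^ n\<close> at \<open>h \<otimes> g [^] n\<close> well defined.\<close>

lemma char_on_extend_step:
  assumes fin: "finite (carrier G)" and H: "subgroup H G" and g: "g \<in> carrier G"
    and \<chi>: "char_on H \<chi>" and w: "\<And>n::nat. g [^] n \<in> H \<Longrightarrow> \<chi> (g [^] n) = w ^ n" and w0: "w \<noteq> 0"
  obtains \<chi>' where "char_on {h \<otimes> g [^] n |h n::nat. h \<in> H} \<chi>'" "\<And>h. h \<in> H \<Longrightarrow> \<chi>' h = \<chi> h" "\<chi>' g = w"
proof -
  have HG: "\<And>h. h \<in> H \<Longrightarrow> h \<in> carrier G" using subgroup.subset[OF H] by blast
  have aux: "\<chi> h * w ^ n = \<chi> h' * w ^ n'"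
    if "h \<in> H" "h' \<in> H" "h \<otimes> g [^] n = h' \<otimes> g [^] n'" "n \<le> n'" for h h' and n n' :: nat
  proof -
    have "h \<otimes> g [^] n = (h' \<otimes> g [^] (n' - n)) \<otimes> g [^] n"
      using that g HG by (simp add: m_assoc nat_pow_mult)
    then have h: "h = h' \<otimes> g [^] (n' - n)" using that g HG by (subst (asm) right_cancel) auto
    then have "g [^] (n' - n) = inv h' \<otimes> h"
      using that g HG by (simp add: inv_solve_left)
    then have mem: "g [^] (n' - n) \<in> H"
      using that H by (simp add: subgroup.m_closed subgroup.m_inv_closed)
    have "\<chi> h = \<chi> h' * w ^ (n' - n)"
      using w[OF mem] char_on_mult[OF \<chi> that(2) mem] h by simp
    then show ?thesis using that(4) by (simp flip: power_add)
  qed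
  have wd: "\<chi> h * w ^ n = \<chi> h' * w ^ n'"
    if "h \<in> H" "h' \<in> H" "h \<otimes> g [^] n = h' \<otimes> g [^] n'" for h h' and n n' :: nat
    using aux[OF that] aux[OF that(2,1) that(3)[symmetric]] by (cases "n \<le> n'") auto
  define \<chi>' where "\<chi>' x = (SOME z. \<exists>h n. h \<in> H \<and> x = h \<otimes> g [^] (n::nat) \<and> z = \<chi> h * w ^ n)" for x
  have val: "\<chi>' (h \<otimes> g [^] n) = \<chi> h * w ^ n" if "h \<in> H" for h and n :: nat
  proof -
    have "\<exists>h' n'. h' \<in> H \<and> h \<otimes> g [^] n = h' \<otimes> g [^] (n'::nat) \<and> \<chi>' (h \<otimes> g [^] n) = \<chi> h' * w ^ n'"
      unfolding \<chi>'_def by (rule someI_ex) (use that in blast)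
    then show ?thesis using wd that by metis
  qed
  have agree: "\<chi>' h = \<chi> h" if "h \<in> H" for h
    using val[OF that, of 0] HG[OF that] by simp
  have one: "\<one> \<in> H" using H by (rule subgroup.one_closed)
  show ?thesis
  proof (rule that)
    show "\<chi>' h = \<chi> h" if "h \<in> H" for h by (rule agree) fact
    show "\<chi>' g = w" using val[OF one, of 1] g \<chi> by (simp add: char_on_one)
    show "char_on {h \<otimes> g [^] n |h n::nat. h \<in> H} \<chi>'"
      unfolding char_on_def
    proof (intro conjI ballI)
      show "\<chi>' \<one> = 1" using agree[OF one] \<chi> by (simp add: char_on_one)
      fix x y assume "x \<in> {h \<otimes> g [^] n |h n::nat. h \<in> H}" "y \<in> {h \<otimes> g [^] n |h n::nat. h \<in> H}"
      then obtain h n h' n' where *: "x = h \<otimes> g [^] (n::nat)" "h \<in> H"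
        "y = h' \<otimes> g [^] (n'::nat)" "h' \<in> H" by auto
      have "x \<otimes> y = (h \<otimes> h') \<otimes> g [^] (n + n')"
        using * HG g by (simp add: nat_pow_mult [symmetric] m_ac)
      then show "\<chi>' (x \<otimes> y) = \<chi>' x * \<chi>' y"
        using * H by (simp add: val subgroup.m_closed char_on_mult[OF \<chi>] power_add)
    qed
  qed
qed

lemma adjoin_superset:
  assumes "subgroup H G" "g \<in> carrier G"
  shows "H \<subseteq> {h \<otimes> g [^] n |h n::nat. h \<in> H}" "g \<in> {h \<otimes> g [^] n |h n::nat. h \<in> H}"
proof -
  have "h = h \<otimes> g [^] (0::nat)" if "h \<in> H" for h
    using that subgroup.subset[OF assms(1)] by auto
  then show "H \<subseteq> {h \<otimes> g [^] n |h n::nat. h \<in> H}" by blast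
  have "g = \<one> \<otimes> g [^] (1::nat)" using assms(2) by simp
  then show "g \<in> {h \<otimes> g [^] n |h n::nat. h \<in> H}" using subgroup.one_closed[OF assms(1)] by blast
qed

text \<open>With this \<open>m\<close>, any \<open>m\<close>-th root of \<open>\<chi> (g\<^sup>m)\<close> is an admissible value at \<open>g\<close> for an extension of \<open>\<chi>\<close>.\<close>

lemma relative_order:
  assumes fin: "finite (carrier G)" and H: "subgroup H G" and g: "g \<in> carrier G"
  obtains m :: nat where "m > 0" "g [^] m \<in> H" "\<And>n::nat. g [^] n \<in> H \<Longrightarrow> m dvd n"
proof -
  define m where "m = (LEAST n::nat. n > 0 \<and> g [^] n \<in> H)"
  have "order G > 0 \<and> g [^] order G \<in> H"
    using fin g pow_order_eq_1[OF g] subgroup.one_closed[OF H] by (simp add: order_gt_0_iff_finite)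
  then have m: "m > 0 \<and> g [^] m \<in> H" unfolding m_def by (rule LeastI)
  have "m dvd n" if "g [^] n \<in> H" for n :: nat
  proof (rule ccontr)
    assume "\<not> m dvd n"
    then have r: "n mod m > 0" by (simp add: mod_greater_zero_iff_not_dvd)
    have "g [^] n = g [^] (n mod m) \<otimes> (g [^] m) [^] (n div m)"
      using g by (simp add: nat_pow_pow nat_pow_mult)
    moreover have "(g [^] m) [^] (n div m) \<in> H"
    proof -
      have "(g [^] m) [^] (j::nat) \<in> H" for j
        by (induction j) (use m H in \<open>auto intro: subgroup.one_closed subgroup.m_closed\<close>)
      then show ?thesis .
    qed
    ultimately have "g [^] (n mod m) = g [^] n \<otimes> inv ((g [^] m) [^] (n div m))"
      using g by (simp add: m_assoc)
    then have "g [^] (n mod m) \<in> H"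
      using that H \<open>(g [^] m) [^] (n div m) \<in> H\<close> by (simp add: subgroup.m_closed subgroup.m_inv_closed)
    then have "m \<le> n mod m" using r m_def Least_le[of "\<lambda>n. n > 0 \<and> g [^] n \<in> H" "n mod m"] by simp
    moreover have "n mod m < m" using m by simp
    ultimately show False by linarith
  qed
  then show ?thesis using m that by blast
qed

lemma char_on_nonzero:
  assumes "subgroup H G" "char_on H \<chi>" "x \<in> H"
  shows "\<chi> x \<noteq> 0"
proof -
  have "\<chi> x * \<chi> (inv x) = \<chi> (x \<otimes> inv x)"
    using assms by (simp add: char_on_mult subgroup.m_inv_closed)
  also have "\<dots> = 1"
    using assms subgroup.subset[OF assms(1)] by (simp add: char_on_one subset_iff)
  finally show ?thesis by auto
qed

text \<open>Induction on the number of elements missing from \<open>H\<close>: some \<open>g\<close>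
  outside \<open>H\<close> is adjoined, its value being an \<open>m\<close>-th root of
  \<open>\<chi> (g [^] m)\<close> with \<open>m\<close> the relative order of \<open>g\<close>.
  Complex numbers always have such roots.\<close>

lemma char_on_extend:
  assumes fin: "finite (carrier G)"
  shows "subgroup H G \<Longrightarrow> char_on H \<chi> \<Longrightarrow>
    \<exists>\<chi>'. char_on (carrier G) \<chi>' \<and> (\<forall>h\<in>H. \<chi>' h = \<chi> h)"
proof (induction "card (carrier G) - card H" arbitrary: H \<chi> rule: less_induct)
  case less
  note H = less.prems(1)
  have HG: "H \<subseteq> carrier G" using H by (rule subgroup.subset)
  show ?case
  proof (cases "H = carrier G")
    case True
    then show ?thesis using less.prems by blast
  next
    case False
    then obtain g where g: "g \<in> carrier G" "g \<notin> H" using HG by blast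
    obtain m :: nat where m: "m > 0" "g [^] m \<in> H" "\<And>n::nat. g [^] n \<in> H \<Longrightarrow> m dvd n"
      using relative_order[OF fin H g(1)] by blast
    define c where "c = \<chi> (g [^] m)"
    have c0: "c \<noteq> 0" unfolding c_def by (rule char_on_nonzero[OF H less.prems(2) m(2)])
    define w where "w = rcis (root m (cmod c)) (Arg c / m)"
    have wm: "w ^ m = c"
      unfolding w_def using m(1) by (simp add: DeMoivre2 real_root_pow_pos2 rcis_cmod_Arg)
    have w0: "w \<noteq> 0" using wm c0 m(1) by auto
    have w: "\<chi> (g [^] n) = w ^ n" if n: "g [^] n \<in> H" for n :: nat
    proof -
      obtain j where j: "n = m * j" using m(3)[OF n] by blast
      have "(g [^] m) [^] i \<in> H \<and> \<chi> ((g [^] m) [^] i) = c ^ i" for i :: nat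
        by (induction i) (use m(2) H less.prems(2) in
          \<open>auto simp: char_on_one char_on_mult c_def intro: subgroup.one_closed subgroup.m_closed\<close>)
      then show ?thesis using g(1) by (simp add: j power_mult wm nat_pow_pow [symmetric])
    qed
    let ?K = "{h \<otimes> g [^] n |h n::nat. h \<in> H}"
    obtain \<chi>' where \<chi>': "char_on ?K \<chi>'" "\<And>h. h \<in> H \<Longrightarrow> \<chi>' h = \<chi> h"
      using char_on_extend_step[OF fin H g(1) less.prems(2) w w0] by blast
    have K: "subgroup ?K G" by (rule subgroup_adjoin[OF fin H g(1)])
    have KG: "?K \<subseteq> carrier G" using K by (rule subgroup.subset)
    have sub: "H \<subset> ?K" using adjoin_superset[OF H g(1)] g(2) by blast
    have "card H < card ?K" using sub KG fin by (meson finite_subset psubset_card_mono)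
    moreover have "card ?K \<le> card (carrier G)" using KG fin by (rule card_mono[rotated])
    ultimately have "card (carrier G) - card ?K < card (carrier G) - card H" by linarith
    from less.hyps[OF this K \<chi>'(1)] obtain \<psi> where
      "char_on (carrier G) \<psi>" "\<forall>h\<in>?K. \<psi> h = \<chi>' h" by blast
    then show ?thesis using psubset_imp_subset[OF sub] \<chi>'(2) by (metis (no_types, lifting) subsetD)
  qed
qed

text \<open>Over the trivial subgroup the relative order \<open>m\<close> of \<open>a\<close> is its
  order, which exceeds 1. A primitive \<open>m\<close>-th root of unity is therefore an admissible
  value at \<open>a\<close>, and the character of the cyclic group so obtained extends to
  \<open>G\<close>.\<close>

lemma char_separates:
  assumes fin: "finite (carrier G)" and a: "a \<in> carrier G" "a \<noteq> \<one>"
  shows "\<exists>\<chi>. char_on (carrier G) \<chi> \<and> \<chi> a \<noteq> 1"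
proof -
  have H: "subgroup {\<one>} G" by (rule triv_subgroup)
  obtain m :: nat where m: "m > 0" "a [^] m \<in> {\<one>}" "\<And>n::nat. a [^] n \<in> {\<one>} \<Longrightarrow> m dvd n"
    using relative_order[OF fin H a(1)] by blast
  have m1: "m \<noteq> 1" using m(2) a by auto
  define w where "w = cis (2 * pi / m)"
  have wm: "w ^ m = 1" using m(1) by (simp add: w_def DeMoivre)
  have w0: "w \<noteq> 0" by (simp add: w_def)
  have w1: "w \<noteq> 1"
  proof
    assume "w = 1"
    then have "cos (2 * pi / m) = 1" by (simp add: w_def complex_eq_iff)
    then obtain i :: int where "2 * pi / m = of_int i * 2 * pi"
      using cos_one_2pi_int by auto
    then have "2 * pi * (1 / real m) = 2 * pi * of_int i" by (simp add: mult_ac)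
    then have "1 / real m = of_int i" using pi_gt_zero by (subst (asm) mult_left_cancel) auto
    then have "of_int (i * int m) = (of_int 1 :: real)" using m(1) by (simp add: field_simps)
    then have "i * int m = 1" by (simp only: of_int_eq_iff)
    then show False using m1 m(1) by (metis dvd_triv_right int_dvd_int_iff int_ops(2) nat_dvd_1_iff_1)
  qed
  have ch: "char_on {\<one>} (\<lambda>_. 1)" by (simp add: char_on_def)
  have w: "1 = w ^ n" if "a [^] n \<in> {\<one>}" for n :: nat
    using m(3)[OF that] wm by (auto simp: power_mult)
  obtain \<chi> where \<chi>: "char_on {h \<otimes> a [^] n |h n::nat. h \<in> {\<one>}} \<chi>" "\<chi> a = w"
    using char_on_extend_step[OF fin H a(1) ch w w0] by blast
  obtain \<psi> where "char_on (carrier G) \<psi>" "\<forall>h\<in>{h \<otimes> a [^] n |h n::nat. h \<in> {\<one>}}. \<psi> h = \<chi> h"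
    using char_on_extend[OF fin subgroup_adjoin[OF fin H a(1)] \<chi>(1)] by blast
  moreover from this have "\<psi> a = \<chi> a" using adjoin_superset(2)[OF H a(1)] by simp
  ultimately show ?thesis using \<chi>(2) w1 by (intro exI[of _ \<psi>]) simp
qed

section \<open>Orthogonality relations\<close>

definition characters :: "('a \<Rightarrow> complex) set" where
  "characters = {\<chi>. char_on (carrier G) \<chi> \<and> (\<forall>x. x \<notin> carrier G \<longrightarrow> \<chi> x = 0)}"

lemma character_root_of_unity:
  assumes "char_on (carrier G) \<chi>" "x \<in> carrier G"
  shows "\<chi> x ^ order G = 1"
  using assms char_on_pow[OF assms, of "order G"] pow_order_eq_1[OF assms(2)] by (simp add: char_on_one)

lemma norm_character:
  assumes "finite (carrier G)" "char_on (carrier G) \<chi>" "x \<in> carrier G"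
  shows "cmod (\<chi> x) = 1"
proof -
  have "cmod (\<chi> x) ^ order G = 1"
    using character_root_of_unity[OF assms(2,3)] by (metis norm_one norm_power)
  moreover have "order G > 0" using assms(1) by (simp add: order_gt_0_iff_finite)
  ultimately show ?thesis
    using power_eq_imp_eq_base[of "cmod (\<chi> x)" "order G" 1] by simp
qed

text \<open>On the carrier all values are roots of unity of exponent \<open>order G\<close>; the
  default value 0 elsewhere leaves no further freedom.\<close>

lemma finite_characters:
  assumes "finite (carrier G)"
  shows "finite characters"
proof (rule finite_subset)
  have pos: "order G > 0" using assms by (simp add: order_gt_0_iff_finite)
  show "characters \<subseteq> {f. \<forall>x. (x \<in> carrier G \<longrightarrow> f x \<in> {z. z ^ order G = 1}) \<and> (x \<notin> carrier G \<longrightarrow> f x = 0)}"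
    by (auto simp: characters_def character_root_of_unity)
  show "finite {f. \<forall>x. (x \<in> carrier G \<longrightarrow> f x \<in> {z::complex. z ^ order G = 1}) \<and> (x \<notin> carrier G \<longrightarrow> f x = 0)}"
    using assms finite_roots_unity[of "order G", where 'a = complex] pos by (intro finite_set_of_finite_funs) auto
qed

text \<open>Multiplication by a character \<open>\<psi>\<close> with
  \<open>\<psi> a \<noteq> 1\<close> permutes the characters, so the sum is unchanged when
  multiplied by \<open>\<psi> a\<close>.\<close>

lemma sum_characters:
  assumes fin: "finite (carrier G)" and a: "a \<in> carrier G" "a \<noteq> \<one>"
  shows "(\<Sum>\<chi>\<in>characters. \<chi> a) = 0"
proof -
  obtain \<psi> where \<psi>: "char_on (carrier G) \<psi>" "\<psi> a \<noteq> 1" using char_separates[OF assms] by blast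
  have nz: "\<psi> x \<noteq> 0" if "x \<in> carrier G" for x
    using char_on_nonzero[OF subgroup_self \<psi>(1) that] .
  have inv: "char_on (carrier G) (\<lambda>x. inverse (\<psi> x))" using \<psi>(1) by (simp add: char_on_def)
  have "bij_betw (\<lambda>\<chi> x. \<psi> x * \<chi> x) characters characters"
  proof (rule bij_betw_byWitness[where f' = "\<lambda>\<chi> x. inverse (\<psi> x) * \<chi> x"])
    have cancel: "\<psi> x * (inverse (\<psi> x) * \<chi> x) = \<chi> x" "inverse (\<psi> x) * (\<psi> x * \<chi> x) = \<chi> x"
      if "\<chi> \<in> characters" for \<chi> x
      using that nz[of x] by (cases "x \<in> carrier G"; simp add: characters_def)+
    show "\<forall>\<chi>\<in>characters. (\<lambda>x. inverse (\<psi> x) * (\<psi> x * \<chi> x)) = \<chi>"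
      "\<forall>\<chi>\<in>characters. (\<lambda>x. \<psi> x * (inverse (\<psi> x) * \<chi> x)) = \<chi>"
      using cancel by auto
    have "char_on (carrier G) (\<lambda>x. \<phi> x * \<chi> x)"
      if "char_on (carrier G) \<phi>" "char_on (carrier G) \<chi>" for \<phi> \<chi>
      using that by (simp add: char_on_def)
    then show "(\<lambda>\<chi> x. \<psi> x * \<chi> x) ` characters \<subseteq> characters"
      "(\<lambda>\<chi> x. inverse (\<psi> x) * \<chi> x) ` characters \<subseteq> characters"
      using \<psi>(1) inv by (auto simp: characters_def)
  qed
  from sum.reindex_bij_betw[OF this, of "\<lambda>\<chi>. \<chi> a"]
  have "\<psi> a * (\<Sum>\<chi>\<in>characters. \<chi> a) = (\<Sum>\<chi>\<in>characters. \<chi> a)"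
    by (simp add: sum_distrib_left)
  then show ?thesis using \<psi>(2) by (metis mult_cancel_right1)
qed

lemma sum_character:
  assumes \<chi>: "char_on (carrier G) \<chi>" and b: "b \<in> carrier G" "\<chi> b \<noteq> 1"
  shows "(\<Sum>x\<in>carrier G. \<chi> x) = 0"
proof -
  have "bij_betw (\<lambda>x. b \<otimes> x) (carrier G) (carrier G)"
    by (rule bij_betw_byWitness[where f' = "\<lambda>x. inv b \<otimes> x"])
      (use b in \<open>auto simp: m_assoc [symmetric]\<close>)
  from sum.reindex_bij_betw[OF this, of \<chi>]
  have "\<chi> b * (\<Sum>x\<in>carrier G. \<chi> x) = (\<Sum>x\<in>carrier G. \<chi> x)"
    using b \<chi> by (simp add: sum_distrib_left char_on_mult)
  then show ?thesis using b by (metis mult_cancel_right1)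
qed

definition trivial_character :: "'a \<Rightarrow> complex" where
  "trivial_character x = (if x \<in> carrier G then 1 else 0)"

lemma trivial_character_in: "trivial_character \<in> characters"
  by (auto simp: characters_def char_on_def trivial_character_def)

text \<open>Double counting of the sum of \<open>\<chi> x\<close> over all pairs: summation over
  \<open>x\<close> leaves only the trivial character, summation over \<open>\<chi>\<close> only the
  identity element.\<close>

lemma card_characters:
  assumes fin: "finite (carrier G)"
  shows "card characters = card (carrier G)"
proof -
  have "(\<Sum>\<chi>\<in>characters. \<Sum>x\<in>carrier G. \<chi> x) =
      (\<Sum>\<chi>\<in>characters. if \<chi> = trivial_character then of_nat (card (carrier G)) else 0)"
  proof (rule sum.cong [OF refl])
    fix \<chi> assume \<chi>: "\<chi> \<in> characters"
    show "(\<Sum>x\<in>carrier G. \<chi> x) = (if \<chi> = trivial_character then of_nat (card (carrier G)) else 0)"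
    proof (cases "\<chi> = trivial_character")
      case True
      then show ?thesis by (simp add: trivial_character_def)
    next
      case False
      then obtain b where b: "\<chi> b \<noteq> trivial_character b" by blast
      then have "b \<in> carrier G"
        using \<chi> by (cases "b \<in> carrier G") (auto simp: characters_def trivial_character_def)
      then show ?thesis using False \<chi> b sum_character[of \<chi> b]
        by (auto simp: characters_def trivial_character_def)
    qed
  qed
  also have "\<dots> = of_nat (card (carrier G))"
    using finite_characters[OF fin] trivial_character_in by simp
  finally have 1: "(\<Sum>\<chi>\<in>characters. \<Sum>x\<in>carrier G. \<chi> x) = of_nat (card (carrier G))" .
  have "(\<Sum>\<chi>\<in>characters. \<Sum>x\<in>carrier G. \<chi> x) = (\<Sum>x\<in>carrier G. \<Sum>\<chi>\<in>characters. \<chi> x)"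
    by (rule sum.swap)
  also have "\<dots> = (\<Sum>x\<in>carrier G. if x = \<one> then of_nat (card characters) else 0)"
  proof (intro sum.cong refl)
    fix x assume x: "x \<in> carrier G"
    have "(\<Sum>\<chi>\<in>characters. \<chi> \<one>) = (\<Sum>\<chi>\<in>characters. 1)"
      by (rule sum.cong) (auto simp: characters_def char_on_one)
    then show "(\<Sum>\<chi>\<in>characters. \<chi> x) = (if x = \<one> then of_nat (card characters) else 0)"
      using sum_characters[OF fin x] by simp
  qed
  also have "\<dots> = of_nat (card characters)" using fin by simp
  finally show ?thesis using 1 by (metis of_nat_eq_iff)
qed

lemma characters_orthogonal:
  assumes fin: "finite (carrier G)" and a: "a \<in> carrier G" and b: "b \<in> carrier G"
  shows "(\<Sum>\<chi>\<in>characters. \<chi> a * cnj (\<chi> b)) = (if a = b then of_nat (card (carrier G)) else 0)"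
proof -
  have "\<chi> a * cnj (\<chi> b) = \<chi> (a \<otimes> inv b)" if "\<chi> \<in> characters" for \<chi>
  proof -
    have \<chi>: "char_on (carrier G) \<chi>" using that by (simp add: characters_def)
    have "\<chi> b * \<chi> (inv b) = 1"
      using \<chi> b by (simp flip: char_on_mult add: char_on_one)
    moreover have "\<chi> b * cnj (\<chi> b) = 1"
      using norm_character[OF fin \<chi> b] by (simp flip: complex_norm_square)
    ultimately have "cnj (\<chi> b) = \<chi> (inv b)" by (metis mult_cancel_left mult_zero_left zero_neq_one)
    then show ?thesis using \<chi> a b by (simp add: char_on_mult)
  qed
  then have "(\<Sum>\<chi>\<in>characters. \<chi> a * cnj (\<chi> b)) = (\<Sum>\<chi>\<in>characters. \<chi> (a \<otimes> inv b))"
    by (rule sum.cong[OF refl])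
  moreover have "(\<Sum>\<chi>\<in>characters. \<chi> \<one>) = of_nat (card (carrier G))"
  proof -
    have "(\<Sum>\<chi>\<in>characters. \<chi> \<one>) = (\<Sum>\<chi>\<in>characters. 1)"
      by (rule sum.cong) (auto simp: characters_def char_on_one)
    then show ?thesis by (simp add: card_characters[OF fin])
  qed
  moreover have "a \<otimes> inv b \<noteq> \<one>" if "a \<noteq> b"
    using that a b by (metis inv_closed inv_equality inv_inv)
  ultimately show ?thesis
    using a b sum_characters[OF fin, of "a \<otimes> inv b"] by auto
qed

end

section \<open>Dirichlet characters\<close>

text \<open>\<open>X\<close> consists of the characters of the unit group, pulled back along
  reduction modulo \<open>q\<close>. The default value 0 off the carrier becomes the vanishing at
  numbers not coprime to \<open>q\<close>.\<close>

theorem dirichlet_characters_orthogonal: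
  assumes q: "q > 1"
  obtains X where "finite X" "card X = totient q" "principal_character q \<in> X"
    "\<And>\<chi>. \<chi> \<in> X \<Longrightarrow> dirichlet_character q \<chi>"
    "\<And>M N. coprime M q \<Longrightarrow> coprime N q \<Longrightarrow>
       (\<Sum>\<chi>\<in>X. \<chi> M * cnj (\<chi> N)) = (if [M = N] (mod q) then of_nat (totient q) else 0)"
proof -
  interpret R: residues "int q" "residue_ring (int q)"
    by unfold_locales (use q in auto)
  let ?G = "units_of (residue_ring (int q))"
  interpret G: comm_group ?G by (rule R.units_comm_group)
  have carr: "x \<in> carrier ?G \<longleftrightarrow> 0 < x \<and> x < int q \<and> coprime x (int q)" for x
    by (simp add: units_of_carrier R.res_units_eq)
  have fin: "finite (carrier ?G)" by (simp add: units_of_carrier)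
  have card: "card (carrier ?G) = totient q"
    using R.totient_eq by (simp add: units_of_carrier)
  have mem: "int n mod int q \<in> carrier ?G \<longleftrightarrow> coprime n q" for n
  proof
    assume "coprime n q"
    then have "coprime (int n) (int q)" by simp
    then show "int n mod int q \<in> carrier ?G"
      using q R.mod_in_res_units[of "int n"] by (simp add: units_of_carrier)
  next
    assume "int n mod int q \<in> carrier ?G"
    then have "coprime (int n mod int q) (int q)" by (simp add: carr)
    then show "coprime n q" using q by (simp add: coprime_mod_left_iff)
  qed
  define D :: "(int \<Rightarrow> complex) \<Rightarrow> nat \<Rightarrow> complex" where "D \<psi> n = \<psi> (int n mod int q)" for \<psi> n
  have inj: "inj_on D G.characters"
  proof (rule inj_onI)
    fix \<psi> \<phi> assume *: "\<psi> \<in> G.characters" "\<phi> \<in> G.characters" "D \<psi> = D \<phi>"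
    show "\<psi> = \<phi>"
    proof
      fix x
      show "\<psi> x = \<phi> x"
      proof (cases "x \<in> carrier ?G")
        case True
        then show ?thesis using fun_cong[OF *(3), of "nat x"] by (simp add: D_def carr)
      next
        case False
        then show ?thesis using *(1,2) by (simp add: G.characters_def)
      qed
    qed
  qed
  show ?thesis
  proof (rule that)
    show "finite (D ` G.characters)" using G.finite_characters[OF fin] by simp
    show "card (D ` G.characters) = totient q"
      using inj by (simp add: card_image G.card_characters[OF fin] card)
    have "D G.trivial_character = principal_character q"
      by (rule ext) (simp add: D_def G.trivial_character_def principal_character_def mem)
    then show "principal_character q \<in> D ` G.characters"
      using imageI[OF G.trivial_character_in, of D] by simp
    show "dirichlet_character q \<chi>" if \<chi>: "\<chi> \<in> D ` G.characters" for \<chi>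
    proof -
      obtain \<psi> where \<psi>: "G.char_on (carrier ?G) \<psi>" "\<And>x. x \<notin> carrier ?G \<Longrightarrow> \<psi> x = 0" "\<chi> = D \<psi>"
        using \<chi> unfolding G.characters_def by blast
      have "D \<psi> 1 = 1"
        using G.char_on_one[OF \<psi>(1)] q by (simp add: D_def units_of_one R.res_one_eq)
      moreover have "D \<psi> (m * n) = D \<psi> m * D \<psi> n" for m n
      proof (cases "coprime m q \<and> coprime n q")
        case True
        then have "\<psi> ((int m mod int q) \<otimes>\<^bsub>?G\<^esub> (int n mod int q)) = D \<psi> m * D \<psi> n"
          unfolding D_def by (intro G.char_on_mult[OF \<psi>(1)]) (auto simp: mem)
        then show ?thesis by (simp add: units_of_mult R.mult_cong D_def)
      next
        case False
        then have "\<not> coprime (m * n) q" by auto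
        then have "D \<psi> (m * n) = 0" unfolding D_def by (intro \<psi>(2)) (simp add: mem del: of_nat_mult)
        moreover have "D \<psi> m = 0 \<or> D \<psi> n = 0" unfolding D_def using False mem \<psi>(2) by blast
        ultimately show ?thesis by auto
      qed
      moreover have "D \<psi> (n + q) = D \<psi> n" for n by (simp add: D_def)
      moreover have "D \<psi> n = 0 \<longleftrightarrow> \<not> coprime n q" for n
        unfolding D_def using mem[of n] \<psi>(2) G.char_on_nonzero[OF G.subgroup_self \<psi>(1)] by blast
      ultimately show ?thesis unfolding dirichlet_character_def \<psi>(3) by blast
    qed
    fix M N assume MN: "coprime M q" "coprime N q"
    have "(\<Sum>\<chi>\<in>D ` G.characters. \<chi> M * cnj (\<chi> N)) =
        (\<Sum>\<psi>\<in>G.characters. \<psi> (int M mod int q) * cnj (\<psi> (int N mod int q)))"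
      using inj by (simp add: sum.reindex D_def)
    also have "\<dots> = (if int M mod int q = int N mod int q then of_nat (totient q) else 0)"
      using MN by (subst G.characters_orthogonal[OF fin]) (simp_all add: mem card)
    also have "int M mod int q = int N mod int q \<longleftrightarrow> [M = N] (mod q)"
      by (simp add: unique_euclidean_semiring_class.cong_def flip: zmod_int)
    finally show "(\<Sum>\<chi>\<in>D ` G.characters. \<chi> M * cnj (\<chi> N)) = (if [M = N] (mod q) then of_nat (totient q) else 0)" .
  qed
qed

text \<open>Elements of \<open>S\<close> lie below \<open>q\<close>, so congruent ones are equal and
  only the diagonal survives when the square is expanded. This is what \<open>x ^ k < q\<close> is
  for.\<close>

corollary dirichlet_parseval:
  fixes F :: "nat \<Rightarrow> complex"
  assumes q: "q > 1" and S: "S \<subseteq> {n. n < q \<and> coprime n q}"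
  obtains X where "finite X" "card X = totient q" "principal_character q \<in> X"
    "\<And>\<chi>. \<chi> \<in> X \<Longrightarrow> dirichlet_character q \<chi>"
    "(\<Sum>\<chi>\<in>X. (cmod (\<Sum>N\<in>S. F N * \<chi> N))\<^sup>2) = totient q * (\<Sum>N\<in>S. (cmod (F N))\<^sup>2)"
proof -
  from dirichlet_characters_orthogonal[OF q] obtain X where X: "finite X" "card X = totient q" "principal_character q \<in> X"
    "\<And>\<chi>. \<chi> \<in> X \<Longrightarrow> dirichlet_character q \<chi>" and
    orth: "\<And>M N. coprime M q \<Longrightarrow> coprime N q \<Longrightarrow>
       (\<Sum>\<chi>\<in>X. \<chi> M * cnj (\<chi> N)) = (if [M = N] (mod q) then of_nat (totient q) else 0)"
    by blast
  have fS: "finite S" using S by (rule finite_subset) simp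
  have "of_real (\<Sum>\<chi>\<in>X. (cmod (\<Sum>N\<in>S. F N * \<chi> N))\<^sup>2) =
      (\<Sum>\<chi>\<in>X. \<Sum>M\<in>S. \<Sum>N\<in>S. (F M * cnj (F N)) * (\<chi> M * cnj (\<chi> N)))"
    by (simp add: complex_norm_square sum_product mult_ac del: of_real_power)
  also have "\<dots> = (\<Sum>M\<in>S. \<Sum>N\<in>S. \<Sum>\<chi>\<in>X. (F M * cnj (F N)) * (\<chi> M * cnj (\<chi> N)))"
    by (subst sum.swap) (intro sum.cong refl sum.swap)
  also have "\<dots> = (\<Sum>M\<in>S. \<Sum>N\<in>S. if M = N then of_nat (totient q) * (F M * cnj (F M)) else 0)"
  proof (intro sum.cong refl)
    fix M N assume MN: "M \<in> S" "N \<in> S"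
    then have "[M = N] (mod q) \<longleftrightarrow> M = N" using S by (auto simp: unique_euclidean_semiring_class.cong_def subset_iff)
    then show "(\<Sum>\<chi>\<in>X. (F M * cnj (F N)) * (\<chi> M * cnj (\<chi> N))) =
        (if M = N then of_nat (totient q) * (F M * cnj (F M)) else 0)"
      using orth[OF subsetD[OF S MN(1), simplified, THEN conjunct2] subsetD[OF S MN(2), simplified, THEN conjunct2]]
      by (auto simp flip: sum_distrib_left)
  qed
  also have "\<dots> = of_real (totient q * (\<Sum>N\<in>S. (cmod (F N))\<^sup>2))"
    using fS by (simp add: complex_norm_square sum_distrib_left del: of_real_power)
  finally have "(\<Sum>\<chi>\<in>X. (cmod (\<Sum>N\<in>S. F N * \<chi> N))\<^sup>2) = totient q * (\<Sum>N\<in>S. (cmod (F N))\<^sup>2)"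
    by (simp only: of_real_eq_iff)
  with X that show ?thesis by blast
qed

section \<open>Sums over sifted sets\<close>

definition Omega :: "nat \<Rightarrow> nat" where
  "Omega n = size (prime_factorization n)"

lemma Omega_1 [simp]: "Omega (Suc 0) = 0"
  by (simp add: Omega_def prime_factorization_1 flip: One_nat_def)

lemma Omega_mult: "m > 0 \<Longrightarrow> n > 0 \<Longrightarrow> Omega (m * n) = Omega m + Omega n"
  by (simp add: Omega_def prime_factorization_mult)

lemma Omega_prime: "prime p \<Longrightarrow> Omega p = 1"
  by (simp add: Omega_def prime_factorization_prime)

lemma divisors_prime_mult:
  assumes "prime (p::nat)"
  shows "{d. d dvd p * m} = {d. d dvd m} \<union> (*) p ` {d. d dvd m}"
proof (intro equalityI subsetI)
  fix d assume "d \<in> {d. d dvd p * m}"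
  then have d: "d dvd p * m" by simp
  show "d \<in> {d. d dvd m} \<union> (*) p ` {d. d dvd m}"
  proof (cases "p dvd d")
    case True
    then obtain e where "d = p * e" by blast
    then show ?thesis using d prime_gt_0_nat[OF assms] by simp
  next
    case False
    then have "coprime d p" using assms prime_imp_coprime coprime_commute by blast
    then show ?thesis using d by (simp add: coprime_dvd_mult_right_iff)
  qed
qed auto

lemma sum_prime_mult_divisors_Omega:
  assumes "prime p" "m > 0"
  shows "(\<Sum>d\<in>(*) p ` {d. d dvd m}. r ^ Omega d) = r * (\<Sum>d | d dvd m. (r::real) ^ Omega d)"
proof -
  have "inj_on ((*) p) {d. d dvd m}" using prime_gt_0_nat[OF assms(1)] by (auto intro: inj_onI)
  then have "(\<Sum>d\<in>(*) p ` {d. d dvd m}. r ^ Omega d) = (\<Sum>d | d dvd m. r ^ Omega (p * d))"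
    by (subst sum.reindex) simp_all
  also have "\<dots> = (\<Sum>d | d dvd m. r * r ^ Omega d)"
    using assms prime_gt_0_nat[OF assms(1)]
    by (intro sum.cong refl) (auto simp: Omega_mult Omega_prime dvd_pos_nat)
  finally show ?thesis by (simp only: sum_distrib_left)
qed

text \<open>Passing from \<open>m\<close> to \<open>p * m\<close> adjoins the divisors
  \<open>p * d\<close>, which multiplies the sum by at most \<open>1 + r\<close>. The old and new
  divisors overlap when \<open>p\<close> divides \<open>m\<close>; for squarefree numbers they do
  not, and equality holds. The inequality serves the lower bounds for sums of
  \<open>(1 + r) ^ Omega n\<close>, the identity the upper bounds.\<close>

lemma sum_divisors_Omega_le:
  fixes r :: real
  assumes "r \<ge> 0" "n > 0"
  shows "(\<Sum>d | d dvd n. r ^ Omega d) \<le> (1 + r) ^ Omega n"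
  using assms(2)
proof (induction n rule: prime_divisors_induct)
  case (factor p m)
  then have m: "m > 0" by simp
  have "(\<Sum>d | d dvd p * m. r ^ Omega d) \<le>
      (\<Sum>d | d dvd m. r ^ Omega d) + (\<Sum>d\<in>(*) p ` {d. d dvd m}. r ^ Omega d)"
    unfolding divisors_prime_mult[OF factor(1)] using m assms(1)
    by (subst sum.union_inter [symmetric]) (auto intro!: sum_nonneg)
  also have "\<dots> = (1 + r) * (\<Sum>d | d dvd m. r ^ Omega d)"
    by (subst sum_prime_mult_divisors_Omega[OF factor(1) m]) (simp add: algebra_simps)
  also have "\<dots> \<le> (1 + r) * (1 + r) ^ Omega m"
    using factor m assms(1) by (intro mult_left_mono) auto
  also have "\<dots> = (1 + r) ^ Omega (p * m)"
    using factor(1) m by (simp add: Omega_mult Omega_prime prime_gt_0_nat)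
  finally show ?case .
qed auto

lemma sum_divisors_Omega_squarefree:
  fixes r :: real
  assumes "squarefree n"
  shows "(\<Sum>d | d dvd n. r ^ Omega d) = (1 + r) ^ Omega n"
  using assms
proof (induction n rule: prime_divisors_induct)
  case (factor p m)
  then have m: "m > 0" using not_squarefree_0[where 'a = nat] by (cases "m = 0") auto
  have pm: "\<not> p dvd m"
  proof
    assume "p dvd m"
    then have "p ^ 2 dvd p * m" by (simp add: power2_eq_square)
    then show False using factor(1,3) by (auto dest: squarefreeD)
  qed
  have sm: "squarefree m" using factor(3) by (rule squarefree_mono[rotated]) simp
  have "(\<Sum>d | d dvd p * m. r ^ Omega d) =
      (\<Sum>d | d dvd m. r ^ Omega d) + (\<Sum>d\<in>(*) p ` {d. d dvd m}. r ^ Omega d)"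
    unfolding divisors_prime_mult[OF factor(1)] using m pm
    by (intro sum.union_disjoint) (auto dest: dvd_mult_left)
  also have "\<dots> = (1 + r) * (\<Sum>d | d dvd m. r ^ Omega d)"
    by (subst sum_prime_mult_divisors_Omega[OF factor(1) m]) (simp add: algebra_simps)
  also have "\<dots> = (1 + r) ^ Omega (p * m)"
    using factor(1,2) m sm by (simp add: Omega_mult Omega_prime prime_gt_0_nat)
  finally show ?case .
qed auto

section \<open>The elementary sieve\<close>

definition sifted :: "nat set \<Rightarrow> real \<Rightarrow> nat set" where
  "sifted D y = {n. 0 < n \<and> real n \<le> y \<and> (\<forall>p\<in>D. \<not> p dvd n)}"

lemma sifted_subset: "sifted D y \<subseteq> {1..nat \<lfloor>y\<rfloor>}"
  by (auto simp: sifted_def le_nat_floor)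

lemma finite_sifted [simp, intro]: "finite (sifted D y)"
  using sifted_subset finite_subset by blast

lemma sifted_empty: "sifted {} y = {1..nat \<lfloor>y\<rfloor>}"
proof (cases "y \<ge> 0")
  case True
  then show ?thesis by (auto simp: sifted_def le_nat_iff le_floor_iff)
qed (auto simp: sifted_def)

text \<open>Legendre's recursion: the members divisible by \<open>p\<close> are the
  \<open>p * m\<close> with \<open>m\<close> sifted by \<open>D\<close> alone, since a prime of
  \<open>D\<close> differs from \<open>p\<close> and can divide \<open>p * m\<close> only through
  \<open>m\<close>.\<close>

lemma sifted_insert:
  assumes D: "\<forall>p\<in>D. prime p" and p: "prime p" "p \<notin> D"
  shows "sifted D y = sifted (insert p D) y \<union> (*) p ` sifted D (y / p)"
    and "sifted (insert p D) y \<inter> (*) p ` sifted D (y / p) = {}"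
    and "inj_on ((*) p) (sifted D (y / p))"
proof -
  have p0: "p > 0" using p by (simp add: prime_gt_0_nat)
  show "sifted D y = sifted (insert p D) y \<union> (*) p ` sifted D (y / p)"
  proof (intro equalityI subsetI)
    fix n assume n: "n \<in> sifted D y"
    show "n \<in> sifted (insert p D) y \<union> (*) p ` sifted D (y / p)"
    proof (cases "p dvd n")
      case True
      then obtain m where "n = p * m" by blast
      then have "m \<in> sifted D (y / p)" using n p0 by (auto simp: sifted_def field_simps)
      then show ?thesis using \<open>n = p * m\<close> by blast
    qed (use n in \<open>auto simp: sifted_def\<close>)
  next
    fix n assume "n \<in> sifted (insert p D) y \<union> (*) p ` sifted D (y / p)"
    then show "n \<in> sifted D y"
    proof
      assume "n \<in> (*) p ` sifted D (y / p)"
      then obtain m where m: "n = p * m" "m \<in> sifted D (y / p)" by blast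
      have "\<not> r dvd p * m" if "r \<in> D" for r
        using that D p m(2) by (auto simp: sifted_def prime_dvd_mult_iff dest: primes_dvd_imp_eq)
      then show ?thesis using m p0 by (auto simp: sifted_def field_simps)
    qed (auto simp: sifted_def)
  qed
  show "sifted (insert p D) y \<inter> (*) p ` sifted D (y / p) = {}" by (auto simp: sifted_def)
  show "inj_on ((*) p) (sifted D (y / p))" using p0 by (auto intro: inj_onI)
qed

definition sieve_density :: "nat set \<Rightarrow> real" where
  "sieve_density D = (\<Prod>p\<in>D. 1 - 1 / real p)"

lemma sieve_density_pos:
  assumes "\<forall>p\<in>D. prime p"
  shows "sieve_density D > 0"
  unfolding sieve_density_def
proof (intro prod_pos)
  show "0 < 1 - 1 / real p" if "p \<in> D" for p
    using prime_gt_1_nat[of p] assms that by simp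
qed

lemma sieve_density_le_1:
  assumes "\<forall>p\<in>D. prime p"
  shows "sieve_density D \<le> 1"
  unfolding sieve_density_def
proof (intro prod_le_1)
  show "0 \<le> 1 - 1 / real p \<and> 1 - 1 / real p \<le> 1" if "p \<in> D" for p
    using prime_gt_0_nat[of p] assms that by simp
qed

text \<open>A new prime subtracts a count of the same kind at \<open>y / p\<close>: the main term
  gains the factor \<open>1 - 1 / p\<close> and the error bound doubles.\<close>

lemma card_sifted:
  assumes "finite D" "\<forall>p\<in>D. prime p" "y \<ge> 0"
  shows "\<bar>real (card (sifted D y)) - y * sieve_density D\<bar> \<le> 2 ^ card D"
  using assms
proof (induction D arbitrary: y rule: finite_induct)
  case empty
  have "real (nat \<lfloor>y\<rfloor>) \<le> y" "y < real (nat \<lfloor>y\<rfloor>) + 1" using empty by linarith+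
  moreover have "card (sifted {} y) = nat \<lfloor>y\<rfloor>" by (simp add: sifted_empty)
  ultimately show ?case unfolding sieve_density_def by (simp only: prod.empty card.empty power_0 mult_1_right)
next
  case (insert p D)
  have p: "prime p" and D: "\<forall>p\<in>D. prime p" using insert.prems by auto
  have p0: "real p > 0" using p by (simp add: prime_gt_0_nat)
  have "card (sifted D y) = card (sifted (insert p D) y) + card (sifted D (y / p))"
    using sifted_insert[OF D p insert.hyps(2), of y]
    by (metis card_Un_disjoint card_image finite_imageI finite_sifted)
  then have "real (card (sifted (insert p D) y)) - y * sieve_density (insert p D) =
      (real (card (sifted D y)) - y * sieve_density D) -
      (real (card (sifted D (y / p))) - y / p * sieve_density D)"
    using insert.hyps by (simp add: sieve_density_def algebra_simps)
  moreover have "\<bar>real (card (sifted D y)) - y * sieve_density D\<bar> \<le> 2 ^ card D"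
    using insert.IH D insert.prems by blast
  moreover have "\<bar>real (card (sifted D (y / p))) - y / p * sieve_density D\<bar> \<le> 2 ^ card D"
    using insert.IH[of "y / p"] D insert.prems p0 by simp
  moreover have "(2::real) ^ card (insert p D) = 2 ^ card D + 2 ^ card D" using insert.hyps by simp
  ultimately show ?case by linarith
qed

lemma harmonic_bounds:
  assumes "y \<ge> 1"
  shows "ln y \<le> (\<Sum>n\<in>sifted {} y. 1 / real n)" "(\<Sum>n\<in>sifted {} y. 1 / real n) \<le> 1 + ln y"
proof -
  have bounds: "ln (real n + 1) \<le> (\<Sum>i=1..n. 1 / real i)"
    "n > 0 \<Longrightarrow> (\<Sum>i=1..n. 1 / real i) \<le> 1 + ln (real n)" for n
  proof (induction n)
    case (Suc n)
    {
      case 1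
      have "ln ((real n + 2) / (real n + 1)) \<le> (real n + 2) / (real n + 1) - 1"
        by (intro ln_le_minus_one) auto
      also have "\<dots> = 1 / (real n + 1)" by (simp add: field_simps)
      finally have "ln (real n + 2) \<le> ln (real n + 1) + 1 / (real n + 1)" by (simp add: ln_div)
      then show ?case using Suc(1) by (simp add: add_ac)
    next
      case 2
      show ?case
      proof (cases "n = 0")
        case False
        have "ln (real n / (real n + 1)) \<le> real n / (real n + 1) - 1"
          using False by (intro ln_le_minus_one) auto
        also have "\<dots> = - 1 / (real n + 1)" by (simp add: field_simps)
        finally have "ln (real n) + 1 / (real n + 1) \<le> ln (real n + 1)" using False by (simp add: ln_div)
        then show ?thesis using Suc(2) False by (simp add: add_ac)
      qed simp
    }
  qed auto
  define n where "n = nat \<lfloor>y\<rfloor>"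
  have n: "n > 0" "real n \<le> y" "y \<le> real n + 1" using assms unfolding n_def by linarith+
  have "ln y \<le> ln (real n + 1)" using n assms by simp
  then show "ln y \<le> (\<Sum>n\<in>sifted {} y. 1 / real n)"
    using bounds(1)[of n] by (simp add: sifted_empty n_def)
  have "ln (real n) \<le> ln y" using n assms by simp
  then show "(\<Sum>n\<in>sifted {} y. 1 / real n) \<le> 1 + ln y"
    using bounds(2)[OF n(1)] by (simp add: sifted_empty n_def)
qed

text \<open>Reciprocal weights avoid the exponential error of counting. The multiples of
  \<open>p\<close> contribute \<open>1 / p\<close> times the sum up to \<open>y / p\<close>, and
  enlarging \<open>y / p\<close> to \<open>y\<close> errs in the favourable direction.\<close>

lemma sum_inverse_sifted:
  assumes "finite D" "\<forall>p\<in>D. prime p" "y \<ge> 1"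
  shows "sieve_density D * ln y \<le> (\<Sum>n\<in>sifted D y. 1 / real n)"
  using assms
proof (induction D rule: finite_induct)
  case empty
  then show ?case using harmonic_bounds(1) by (simp add: sieve_density_def)
next
  case (insert p D)
  have p: "prime p" and D: "\<forall>p\<in>D. prime p" using insert.prems by auto
  have p0: "real p > 0" "1 / real p \<le> 1" using prime_gt_0_nat[OF p] by auto
  note si = sifted_insert[OF D p insert.hyps(2), of y]
  have "(\<Sum>n\<in>sifted D y. 1 / real n) =
      (\<Sum>n\<in>sifted (insert p D) y. 1 / real n) + (\<Sum>n\<in>(*) p ` sifted D (y / p). 1 / real n)"
    by (subst si(1), rule sum.union_disjoint) (use si(2) in auto)
  also have "(\<Sum>n\<in>(*) p ` sifted D (y / p). 1 / real n) = 1 / p * (\<Sum>n\<in>sifted D (y / p). 1 / real n)"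
    using si(3) by (simp add: sum.reindex sum_distrib_left)
  also have "\<dots> \<le> 1 / p * (\<Sum>n\<in>sifted D y. 1 / real n)"
  proof (intro mult_left_mono sum_mono2)
    have "y / p \<le> y" using p0 insert.prems by (simp add: field_simps)
    then show "sifted D (y / p) \<subseteq> sifted D y" by (auto simp: sifted_def)
  qed auto
  finally have "(1 - 1 / p) * (\<Sum>n\<in>sifted D y. 1 / real n) \<le> (\<Sum>n\<in>sifted (insert p D) y. 1 / real n)"
    by (simp add: algebra_simps)
  moreover have "(1 - 1 / p) * (sieve_density D * ln y) \<le> (1 - 1 / p) * (\<Sum>n\<in>sifted D y. 1 / real n)"
    using insert.IH D insert.prems p0 by (intro mult_left_mono) auto
  ultimately show ?case using insert.hyps by (simp add: sieve_density_def mult_ac)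
qed

section \<open>Lower bounds over sifted sets\<close>

lemma sum_Omega_sifted_step:
  fixes r :: real
  assumes D: "\<forall>p\<in>D. prime p" and r: "r \<ge> 0"
  shows "(\<Sum>e\<in>sifted D t. \<Sum>m\<in>sifted D (y / e). r ^ Omega m) \<le> (\<Sum>n\<in>sifted D y. (1 + r) ^ Omega n)"
proof -
  let ?P = "SIGMA e:sifted D t. sifted D (y / e)"
  \<comment> \<open>A pair \<open>(e, m)\<close> is recorded as the number \<open>e * m\<close> with
    its divisor \<open>m\<close>. Not every divisor arises, because \<open>e \<le> t\<close>; a
    lower bound can afford this.\<close>
  have inj: "inj_on (\<lambda>(e, m). (e * m, m)) ?P"
    by (rule inj_onI) (auto simp: sifted_def)
  have "(\<Sum>e\<in>sifted D t. \<Sum>m\<in>sifted D (y / e). r ^ Omega m) = (\<Sum>(e, m)\<in>?P. r ^ Omega m)"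
    by (rule sum.Sigma) auto
  also have "\<dots> = (\<Sum>(n, d)\<in>(\<lambda>(e, m). (e * m, m)) ` ?P. r ^ Omega d)"
    by (subst sum.reindex[OF inj]) (simp add: case_prod_unfold)
  also have "\<dots> \<le> (\<Sum>(n, d)\<in>(SIGMA n:sifted D y. {d. d dvd n}). r ^ Omega d)"
  proof (intro sum_mono2)
    show "finite (SIGMA n:sifted D y. {d. d dvd n})"
      by (intro finite_SigmaI) (simp, simp add: sifted_def)
    show "(\<lambda>(e, m). (e * m, m)) ` ?P \<subseteq> (SIGMA n:sifted D y. {d. d dvd n})"
      using D by (auto simp: sifted_def field_simps prime_dvd_mult_iff)
  qed (use r in auto)
  also have "\<dots> = (\<Sum>n\<in>sifted D y. \<Sum>d | d dvd n. r ^ Omega d)"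
    by (rule sum.Sigma [symmetric]) (simp, simp add: sifted_def)
  also have "\<dots> \<le> (\<Sum>n\<in>sifted D y. (1 + r) ^ Omega n)"
    using r by (intro sum_mono sum_divisors_Omega_le) (auto simp: sifted_def)
  finally show ?thesis .
qed

text \<open>Each induction step gains the reciprocal sum over \<open>e \<le> t\<close>, at least
  \<open>sieve_density D * ln t\<close>. The truncation at \<open>t\<close> keeps
  \<open>y / e\<close> above the threshold for the next smaller \<open>j\<close>, and the base case
  still has room for the counting error \<open>2 ^ card D\<close> to be at most half of the main
  term.\<close>

lemma sum_Omega_sifted_ge:
  assumes D: "finite D" "\<forall>p\<in>D. prime p" and t: "t \<ge> 1"
    and y: "y \<ge> t ^ j * (2 * 2 ^ card D / sieve_density D)"
  shows "(\<Sum>n\<in>sifted D y. (1 + real j) ^ Omega n) \<ge>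
    sieve_density D / 2 * y * (sieve_density D * ln t) ^ j"
  using y
proof (induction j arbitrary: y)
  case 0
  have \<rho>: "sieve_density D > 0" using D by (simp add: sieve_density_pos)
  have "2 * 2 ^ card D / sieve_density D \<ge> 0" using \<rho> by simp
  then have y0: "y \<ge> 0" using 0 by simp
  have "2 * 2 ^ card D \<le> y * sieve_density D" using 0 \<rho> by (simp add: field_simps)
  then show ?case using card_sifted[OF D y0] by (simp add: mult_ac)
next
  case (Suc j)
  define \<rho> where "\<rho> = sieve_density D"
  have \<rho>: "\<rho> > 0" using D by (simp add: sieve_density_pos \<rho>_def)
  have "t ^ Suc j * (2 * 2 ^ card D / \<rho>) \<ge> 0" using \<rho> t by simp
  then have y0: "y \<ge> 0" using Suc.prems by (simp add: \<rho>_def)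
  have "\<rho> / 2 * y * (\<rho> * ln t) ^ Suc j = \<rho> / 2 * y * (\<rho> * ln t) ^ j * (\<rho> * ln t)" by simp
  also have "\<dots> \<le> \<rho> / 2 * y * (\<rho> * ln t) ^ j * (\<Sum>e\<in>sifted D t. 1 / real e)"
    using sum_inverse_sifted[OF D t] \<rho> y0 t by (intro mult_left_mono) (auto simp: \<rho>_def)
  also have "\<dots> = (\<Sum>e\<in>sifted D t. \<rho> / 2 * (y / e) * (\<rho> * ln t) ^ j)"
    by (simp add: sum_distrib_left mult_ac)
  also have "\<dots> \<le> (\<Sum>e\<in>sifted D t. \<Sum>m\<in>sifted D (y / e). (1 + real j) ^ Omega m)"
    unfolding \<rho>_def
  proof (intro sum_mono Suc.IH)
    fix e assume "e \<in> sifted D t"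
    then have e: "real e > 0" "real e \<le> t" by (auto simp: sifted_def)
    have "t ^ j * (2 * 2 ^ card D / \<rho>) * e \<le> t ^ j * (2 * 2 ^ card D / \<rho>) * t"
      using e \<rho> t by (intro mult_left_mono) auto
    also have "\<dots> \<le> y" using Suc.prems by (simp add: \<rho>_def mult_ac)
    finally show "t ^ j * (2 * 2 ^ card D / sieve_density D) \<le> y / e"
      using e by (simp add: field_simps \<rho>_def)
  qed
  also have "\<dots> \<le> (\<Sum>n\<in>sifted D y. (1 + (1 + real j)) ^ Omega n)"
    by (rule sum_Omega_sifted_step) (use D in auto)
  finally show ?case by (simp add: \<rho>_def add_ac)
qed

section \<open>Upper bounds, from squarefree to sifted numbers\<close>

definition squarefrees :: "real \<Rightarrow> nat set" where
  "squarefrees y = {n. 0 < n \<and> real n \<le> y \<and> squarefree n}"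

lemma finite_squarefrees [simp, intro]: "finite (squarefrees y)"
  by (rule finite_subset[OF _ finite_sifted[of "{}" y]]) (auto simp: squarefrees_def sifted_def)

text \<open>The power \<open>(1 + r) ^ Omega n\<close> is expanded over the divisors
  \<open>m\<close> of \<open>n\<close>, and it is then forgotten that the cofactor \<open>e\<close>
  is squarefree and coprime to \<open>m\<close>.\<close>

lemma sum_Omega_squarefrees_step:
  fixes r :: real
  assumes r: "r \<ge> 0"
  shows "(\<Sum>n\<in>squarefrees y. (1 + r) ^ Omega n) \<le> (\<Sum>e\<in>sifted {} y. \<Sum>m\<in>squarefrees (y / e). r ^ Omega m)"
proof -
  let ?P = "SIGMA n:squarefrees y. {d. d dvd n}"
  have inj: "inj_on (\<lambda>(n, d). (n div d, d)) ?P"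
    by (rule inj_onI) (auto simp: squarefrees_def)
  have "(\<Sum>n\<in>squarefrees y. (1 + r) ^ Omega n) = (\<Sum>n\<in>squarefrees y. \<Sum>d | d dvd n. r ^ Omega d)"
    by (intro sum.cong refl sum_divisors_Omega_squarefree [symmetric]) (simp add: squarefrees_def)
  also have "\<dots> = (\<Sum>(n, d)\<in>?P. r ^ Omega d)"
    by (rule sum.Sigma) (simp, simp add: squarefrees_def)
  also have "\<dots> = (\<Sum>(e, m)\<in>(\<lambda>(n, d). (n div d, d)) ` ?P. r ^ Omega m)"
    by (subst sum.reindex[OF inj]) (simp add: case_prod_unfold)
  also have "\<dots> \<le> (\<Sum>(e, m)\<in>(SIGMA e:sifted {} y. squarefrees (y / e)). r ^ Omega m)"
  proof (intro sum_mono2)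
    show "(\<lambda>(n, d). (n div d, d)) ` ?P \<subseteq> (SIGMA e:sifted {} y. squarefrees (y / e))"
    proof (clarsimp simp: squarefrees_def sifted_def, intro conjI)
      fix n d :: nat assume *: "0 < n" "real n \<le> y" "squarefree n" "d dvd n"
      then obtain e where e: "n = d * e" by blast
      then have d: "d > 0" "e > 0" using *(1) by auto
      have "real e * 1 \<le> real e * real d" using d by (intro mult_left_mono) auto
      also have "\<dots> \<le> y" using *(2) e by (simp add: mult_ac)
      finally show "real (n div d) \<le> y" using e d by simp
      show "0 < n div d" "0 < d" using e d by simp_all
      show "real d \<le> y / real (n div d)" using *(2) e d by (simp add: field_simps)
      show "squarefree d" using *(3,4) squarefree_mono by blast
    qed
  qed (use r in auto)
  also have "\<dots> = (\<Sum>e\<in>sifted {} y. \<Sum>m\<in>squarefrees (y / e). r ^ Omega m)"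
    by (rule sum.Sigma [symmetric]) auto
  finally show ?thesis .
qed

lemma sum_Omega_squarefrees_le:
  assumes "y \<ge> 1"
  shows "(\<Sum>n\<in>squarefrees y. (1 + real j) ^ Omega n) \<le> y * (1 + ln y) ^ j"
  using assms
proof (induction j arbitrary: y)
  case 0
  have "card (squarefrees y) \<le> card {1..nat \<lfloor>y\<rfloor>}"
    by (intro card_mono) (auto simp: squarefrees_def le_nat_floor)
  then show ?case using 0 by simp linarith
next
  case (Suc j)
  have "(\<Sum>n\<in>squarefrees y. (1 + (1 + real j)) ^ Omega n) \<le>
      (\<Sum>e\<in>sifted {} y. \<Sum>m\<in>squarefrees (y / e). (1 + real j) ^ Omega m)"
    by (rule sum_Omega_squarefrees_step) simp
  also have "\<dots> \<le> (\<Sum>e\<in>sifted {} y. y * (1 + ln y) ^ j * (1 / e))"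
  proof (intro sum_mono)
    fix e assume "e \<in> sifted {} y"
    then have e: "real e \<ge> 1" "real e \<le> y" by (auto simp: sifted_def)
    then have ye: "y / e \<ge> 1" "y / e \<le> y" using Suc.prems by (auto simp: field_simps)
    have "(\<Sum>m\<in>squarefrees (y / e). (1 + real j) ^ Omega m) \<le> y / e * (1 + ln (y / e)) ^ j"
      by (rule Suc.IH[OF ye(1)])
    also have "\<dots> \<le> y / e * (1 + ln y) ^ j"
      using ye Suc.prems by (intro mult_left_mono power_mono) auto
    finally show "(\<Sum>m\<in>squarefrees (y / e). (1 + real j) ^ Omega m) \<le> y * (1 + ln y) ^ j * (1 / e)"
      by simp
  qed
  also have "\<dots> = y * (1 + ln y) ^ j * (\<Sum>e\<in>sifted {} y. 1 / e)" by (simp add: sum_distrib_left)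
  also have "\<dots> \<le> y * (1 + ln y) ^ j * (1 + ln y)"
    using harmonic_bounds(2)[OF Suc.prems] Suc.prems by (intro mult_left_mono) auto
  finally show ?case by (simp add: add_ac mult_ac)
qed

text \<open>The induction needs the sharper bound \<open>3 - 2 / sqrt n\<close>, whose increments
  telescope against the terms.\<close>

lemma sum_three_halves:
  "(\<Sum>e=1..n. 1 / (real e * sqrt (real e))) \<le> 3"
proof -
  have "n > 0 \<Longrightarrow> (\<Sum>e=1..n. 1 / (real e * sqrt (real e))) \<le> 3 - 2 / sqrt (real n)"
  proof (induction n)
    case (Suc n)
    show ?case
    proof (cases "n = 0")
      case False
      define a b where "a = sqrt (real n)" and "b = sqrt (real n + 1)"
      have ab: "0 < a" "a \<le> b" "b ^ 2 - a ^ 2 = 1" "b ^ 2 = real n + 1"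
        using False by (auto simp: a_def b_def)
      have "a * b * (a + b) \<le> b * b * (b + b)" using ab by (intro mult_mono) auto
      then have "1 / (b ^ 2 * b) \<le> 2 / (a * b * (a + b))"
        using ab by (simp add: frac_le divide_simps power2_eq_square mult_ac)
      also have "\<dots> = 2 * (b ^ 2 - a ^ 2) / (a * b * (a + b))" using ab by simp
      also have "b ^ 2 - a ^ 2 = (b - a) * (a + b)" by (simp add: power2_eq_square algebra_simps)
      also have "2 * ((b - a) * (a + b)) / (a * b * (a + b)) = 2 * (b - a) / (a * b)" using ab(1,2) by simp
      also have "\<dots> = 2 / a - 2 / b" using ab(1,2) by (simp add: field_simps)
      finally have "1 / ((real n + 1) * sqrt (real n + 1)) \<le> 2 / sqrt (real n) - 2 / sqrt (real n + 1)"
        using ab by (simp add: a_def b_def)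
      then show ?thesis using Suc.IH False by (simp add: add_ac)
    qed simp
  qed simp
  moreover have "3 - 2 / sqrt (real n) \<le> 3" by simp
  ultimately show ?thesis by (cases "n = 0") (simp, metis neq0_conv order_trans)
qed

lemma power_Omega_le:
  assumes "e > 0" "\<And>p. prime p \<Longrightarrow> p dvd e \<Longrightarrow> c \<le> p"
  shows "c ^ Omega e \<le> e"
  using assms
proof (induction e rule: prime_divisors_induct)
  case (factor p m)
  then have m: "m > 0" by simp
  have "c ^ Omega (p * m) = c * c ^ Omega m"
    using factor(1) m by (simp add: Omega_mult Omega_prime prime_gt_0_nat)
  also have "\<dots> \<le> p * m" using factor m by (intro mult_mono) auto
  finally show ?case .
qed auto

text \<open>Writing \<open>N = s e\<^sup>2\<close> with \<open>s\<close> squarefree, the factor coming from \<open>e\<close> contributes a convergent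
  series because \<open>e\<close> has no small prime factors.\<close>

lemma sum_Omega_sifted_le:
  fixes j :: nat
  defines "P \<equiv> {p. prime p \<and> p \<le> (1 + j) ^ 4}"
  assumes y: "y \<ge> 1"
  shows "(\<Sum>n\<in>sifted P y. (1 + real j) ^ Omega n) \<le> 3 * y * (1 + ln y) ^ j"
proof -
  let ?Q = "SIGMA e:sifted P y. squarefrees (y / (real e)\<^sup>2)"
  let ?h = "\<lambda>n. (square_part n, squarefree_part n)"
  let ?g = "\<lambda>(e, s). (1 + real j) ^ (Omega s + 2 * Omega e)"
  have decomp: "?h n \<in> ?Q" "?g (?h n) = (1 + real j) ^ Omega n" if "n \<in> sifted P y" for n
  proof -
    define e s where "e = square_part n" and "s = squarefree_part n"
    have n: "n > 0" "real n \<le> y" "\<And>p. p \<in> P \<Longrightarrow> \<not> p dvd n" using that by (auto simp: sifted_def)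
    have n_eq: "n = s * e\<^sup>2" unfolding e_def s_def by (rule squarefree_decompose)
    have pos: "e > 0" "s > 0" using n(1) n_eq by (auto intro!: Nat.gr0I)
    have "e \<le> n" using n_eq pos by (simp add: power2_eq_square)
    then have "real e \<le> y" using n(2) by linarith
    moreover have "e dvd n" using n_eq by (simp add: power2_eq_square)
    ultimately have "e \<in> sifted P y" using pos n(3) by (auto simp: sifted_def dest: dvd_trans)
    moreover have "real s * (real e)\<^sup>2 \<le> y" using n(2) n_eq by simp
    then have "real s \<le> y / (real e)\<^sup>2" using pos by (simp add: pos_le_divide_eq)
    then have "s \<in> squarefrees (y / (real e)\<^sup>2)"
      using pos squarefree_squarefree_part[of n] n(1) by (simp add: squarefrees_def s_def)
    ultimately show "?h n \<in> ?Q" by (simp add: e_def s_def)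
    have "Omega n = Omega s + 2 * Omega e"
      using pos by (subst n_eq) (simp add: power2_eq_square Omega_mult)
    then show "?g (?h n) = (1 + real j) ^ Omega n" by (simp add: e_def s_def)
  qed
  have inj: "inj_on ?h (sifted P y)"
    by (rule inj_onI) (metis prod.inject squarefree_decompose)
  have "(\<Sum>n\<in>sifted P y. (1 + real j) ^ Omega n) = (\<Sum>x\<in>?h ` sifted P y. ?g x)"
    using decomp(2) by (subst sum.reindex[OF inj]) (auto intro!: sum.cong)
  also have "\<dots> \<le> (\<Sum>x\<in>?Q. ?g x)"
    using decomp(1) by (intro sum_mono2) auto
  also have "\<dots> = (\<Sum>e\<in>sifted P y. \<Sum>s\<in>squarefrees (y / (real e)\<^sup>2). (1 + real j) ^ (Omega s + 2 * Omega e))"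
    by (rule sum.Sigma [symmetric]) auto
  also have "\<dots> \<le> (\<Sum>e\<in>sifted P y. y * (1 + ln y) ^ j * (1 / (real e * sqrt (real e))))"
  proof (intro sum_mono)
    fix e assume e: "e \<in> sifted P y"
    then have e1: "real e \<ge> 1" by (auto simp: sifted_def)
    show "(\<Sum>s\<in>squarefrees (y / (real e)\<^sup>2). (1 + real j) ^ (Omega s + 2 * Omega e)) \<le>
      y * (1 + ln y) ^ j * (1 / (real e * sqrt (real e)))"
    proof (cases "y / (real e)\<^sup>2 \<ge> 1")
      case True
      \<comment> \<open>The fourth power in \<open>P\<close> is chosen for this: it gives
        \<open>(1 + j) ^ (2 * Omega e) \<le> sqrt e\<close>, so the exponent -2 of \<open>e\<close>
        becomes -3/2, which is still summable.\<close>
      have "((1 + j) ^ 4) ^ Omega e \<le> e"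
      proof (rule power_Omega_le)
        show "(1 + j) ^ 4 \<le> p" if "prime p" "p dvd e" for p
          using e that by (auto simp: sifted_def P_def)
      qed (use e in \<open>auto simp: sifted_def\<close>)
      then have "real (((1 + j) ^ 4) ^ Omega e) \<le> real e" by (simp only: of_nat_le_iff)
      moreover have "real (((1 + j) ^ 4) ^ Omega e) = ((1 + real j) ^ (2 * Omega e))\<^sup>2"
        by (simp flip: power_mult add: mult.commute)
      ultimately have "((1 + real j) ^ (2 * Omega e))\<^sup>2 \<le> real e" by simp
      then have sq: "(1 + real j) ^ (2 * Omega e) \<le> sqrt (real e)" by (rule real_le_rsqrt)
      have ye: "y / (real e)\<^sup>2 \<le> y" using e1 y by (simp add: field_simps)
      have "(\<Sum>s\<in>squarefrees (y / (real e)\<^sup>2). (1 + real j) ^ (Omega s + 2 * Omega e)) =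
          (1 + real j) ^ (2 * Omega e) * (\<Sum>s\<in>squarefrees (y / (real e)\<^sup>2). (1 + real j) ^ Omega s)"
        by (simp add: power_add sum_distrib_left mult_ac)
      also have "\<dots> \<le> sqrt (real e) * (y / (real e)\<^sup>2 * (1 + ln (y / (real e)\<^sup>2)) ^ j)"
        using sq sum_Omega_squarefrees_le[OF True] by (intro mult_mono) (auto intro!: sum_nonneg)
      also have "\<dots> \<le> sqrt (real e) * (y / (real e)\<^sup>2 * (1 + ln y) ^ j)"
        using True ye y e1 by (intro mult_left_mono power_mono) auto
      also have "\<dots> = y * (1 + ln y) ^ j * (sqrt (real e) / (real e)\<^sup>2)" by simp
      also have "sqrt (real e) / (real e)\<^sup>2 = 1 / (real e * sqrt (real e))"
        using e1 by (simp add: divide_simps power2_eq_square)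
      finally show ?thesis .
    next
      case False
      then have "squarefrees (y / (real e)\<^sup>2) = {}" by (auto simp: squarefrees_def)
      then show ?thesis using y e1 by simp
    qed
  qed
  also have "\<dots> = y * (1 + ln y) ^ j * (\<Sum>e\<in>sifted P y. 1 / (real e * sqrt (real e)))"
    by (simp add: sum_distrib_left)
  also have "\<dots> \<le> y * (1 + ln y) ^ j * 3"
  proof (rule mult_left_mono)
    have "(\<Sum>e\<in>sifted P y. 1 / (real e * sqrt (real e))) \<le> (\<Sum>e=1..nat \<lfloor>y\<rfloor>. 1 / (real e * sqrt (real e)))"
      using sifted_subset by (intro sum_mono2) auto
    also have "\<dots> \<le> 3" by (rule sum_three_halves)
    finally show "(\<Sum>e\<in>sifted P y. 1 / (real e * sqrt (real e))) \<le> 3" .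
  qed (use y in simp)
  finally show ?thesis by (simp add: mult_ac)
qed

section \<open>Sums over primes\<close>

lemma prod_primes_dvd:
  assumes "finite S" "\<And>p. p \<in> S \<Longrightarrow> prime p" "\<And>p. p \<in> S \<Longrightarrow> p dvd (n::nat)"
  shows "\<Prod>S dvd n"
  using assms
proof (induction S rule: finite_induct)
  case (insert p S)
  have "coprime p (\<Prod>S)"
    using insert by (intro prod_coprime_right) (auto intro!: primes_coprime)
  then show ?case using insert by (simp add: divides_mult)
qed simp

lemma prod_primes_ge:
  assumes "finite S" "\<And>p. p \<in> S \<Longrightarrow> prime p \<and> p dvd n \<and> y \<le> real p" "(n::nat) > 0" "y \<ge> 0"
  shows "y ^ card S \<le> real n"
proof -
  have "y ^ card S = (\<Prod>p\<in>S. y)" by simp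
  also have "\<dots> \<le> (\<Prod>p\<in>S. real p)" using assms by (intro prod_mono) auto
  also have "\<dots> = real (\<Prod>S)" by simp
  also have "\<dots> \<le> real n"
    using prod_primes_dvd[OF assms(1), of n] assms by (simp only: of_nat_le_iff) (auto intro: dvd_imp_le)
  finally show ?thesis .
qed

lemma card_large_prime_divisors:
  assumes "n > 0" "y > 1"
  shows "real (card {p. prime p \<and> p dvd n \<and> y < real p}) * ln y \<le> ln (real n)"
proof -
  let ?S = "{p. prime p \<and> p dvd n \<and> y < real p}"
  have "finite ?S" using assms by (intro finite_subset[OF _ finite_divisors_nat[of n]]) auto
  then have "y ^ card ?S \<le> real n" using assms by (intro prod_primes_ge) auto
  then have "ln (y ^ card ?S) \<le> ln (real n)" using assms by (intro ln_mono) auto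
  then show ?thesis using assms by (simp add: ln_realpow)
qed

text \<open>The primes in \<open>(n, 2n]\<close> divide the central binomial coefficient, which is at most \<open>4\<^sup>n\<close>.\<close>

lemma card_primes_dyadic:
  assumes "n > 1"
  shows "real (card {p. prime p \<and> n < p \<and> p \<le> 2 * n}) * ln (real n) \<le> real n * (2 * ln 2)"
proof -
  let ?S = "{p. prime p \<and> n < p \<and> p \<le> 2 * n}"
  have fin: "finite ?S" by (rule finite_subset[of _ "{..2 * n}"]) auto
  have dvd: "p dvd (2 * n) choose n" if "prime p" "n < p" "p \<le> 2 * n" for p
  proof -
    have "p dvd fact (2 * n)" using that by (simp add: prime_dvd_fact_iff)
    also have "fact (2 * n) = fact n * fact n * ((2 * n) choose n)"
      using binomial_fact_lemma[of n "2 * n"] by simp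
    finally show ?thesis using that by (simp add: prime_dvd_mult_iff prime_dvd_fact_iff)
  qed
  have "real n ^ card ?S \<le> real ((2 * n) choose n)"
    using fin dvd by (intro prod_primes_ge) auto
  also have "\<dots> \<le> real (2 ^ (2 * n))" using binomial_le_pow2[of "2 * n" n] by (simp only: of_nat_le_iff)
  finally have "ln (real n ^ card ?S) \<le> ln (2 ^ (2 * n))" using assms by (intro ln_mono) auto
  then show ?thesis using assms by (simp add: ln_realpow mult_ac)
qed

text \<open>At most \<open>2 * 2 ^ j / j\<close> primes lie above \<open>2 ^ j\<close> and up to
  \<open>2 ^ (j + 1)\<close>, so that block contributes at most \<open>2 / j\<close>. The term 1/2
  is the prime 2.\<close>

lemma sum_primes_dyadic:
  assumes "j > 0"
  shows "(\<Sum>p | prime p \<and> p \<le> 2 ^ j. 1 / real p) \<le> 1 / 2 + 2 * (\<Sum>i=1..<j. 1 / real i)"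
  using assms
proof (induction j)
  case (Suc j)
  show ?case
  proof (cases "j = 0")
    case True
    have "{p::nat. prime p \<and> p \<le> 2} = {2}" by (auto dest: prime_ge_2_nat intro: antisym)
    then show ?thesis using True by simp
  next
    case False
    let ?S = "{p::nat. prime p \<and> 2 ^ j < p \<and> p \<le> 2 * 2 ^ j}"
    have fin: "finite ?S" "finite {p::nat. prime p \<and> p \<le> 2 ^ j}"
      by (auto intro: finite_subset[of _ "{..2 * 2 ^ j}"])
    have "{p::nat. prime p \<and> p \<le> 2 ^ Suc j} = {p. prime p \<and> p \<le> 2 ^ j} \<union> ?S" by auto
    then have "(\<Sum>p | prime p \<and> p \<le> 2 ^ Suc j. 1 / real p) =
        (\<Sum>p | prime p \<and> p \<le> 2 ^ j. 1 / real p) + (\<Sum>p\<in>?S. 1 / real p)"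
      using fin by (auto intro: sum.union_disjoint)
    also have "(\<Sum>p\<in>?S. 1 / real p) \<le> (\<Sum>p\<in>?S. 1 / 2 ^ j)"
    proof (intro sum_mono)
      fix p assume "p \<in> ?S"
      then have "real (2 ^ j) \<le> real p" by (simp only: of_nat_le_iff) simp
      then show "1 / real p \<le> 1 / 2 ^ j" by (simp add: frac_le)
    qed
    also have "\<dots> = real (card ?S) / 2 ^ j" by simp
    also have "\<dots> \<le> 2 / real j"
    proof -
      have "(1::nat) < 2 ^ j" using False by (intro one_less_power) auto
      from card_primes_dyadic[OF this] have "(real (card ?S) * real j) * ln 2 \<le> (2 * 2 ^ j) * ln 2"
        by (simp add: ln_realpow mult_ac)
      then have "real (card ?S) * real j \<le> 2 * 2 ^ j" by (simp add: mult_le_cancel_right_pos)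
      then show ?thesis using False by (simp add: field_simps)
    qed
    also have "(\<Sum>p | prime p \<and> p \<le> 2 ^ j. 1 / real p) \<le> 1 / 2 + 2 * (\<Sum>i=1..<j. 1 / real i)"
      using Suc.IH False by simp
    finally show ?thesis using False by (simp add: algebra_simps)
  qed
qed simp

text \<open>The dyadic bound at the first power of two not below \<open>y\<close>, where
  \<open>j \<le> 2 * log 2 y \<le> 4 * ln y\<close>. The coefficient 2 in place of Mertens' 1 only
  raises the power of \<open>ln (ln q)\<close> that is lost.\<close>

lemma sum_primes_le:
  assumes "y \<ge> 2"
  shows "(\<Sum>p | prime p \<and> real p \<le> y. 1 / real p) \<le> 7 + 2 * ln (ln y)"
proof -
  define j where "j = nat \<lceil>log 2 y\<rceil>"
  have l1: "log 2 y \<ge> 1" using assms by simp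
  then have j: "j > 0" "log 2 y \<le> real j" "real j \<le> 2 * log 2 y" unfolding j_def by linarith+
  have "y = 2 powr (log 2 y)" using assms by simp
  also have "\<dots> \<le> 2 powr (real j)" using j by (intro powr_mono) auto
  finally have y: "y \<le> 2 ^ j" by (simp add: powr_realpow)
  have "{p. prime p \<and> real p \<le> y} \<subseteq> {p. prime p \<and> p \<le> 2 ^ j}"
  proof safe
    fix p assume "real p \<le> y"
    then have "real p \<le> 2 ^ j" using y by linarith
    then show "p \<le> 2 ^ j" by simp
  qed
  then have "(\<Sum>p | prime p \<and> real p \<le> y. 1 / real p) \<le> (\<Sum>p | prime p \<and> p \<le> 2 ^ j. 1 / real p)"
    by (intro sum_mono2 finite_subset[of "{p. prime p \<and> p \<le> 2 ^ j}" "{..2 ^ j}"]) auto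
  also have "\<dots> \<le> 1 / 2 + 2 * (\<Sum>i=1..<j. 1 / real i)" by (rule sum_primes_dyadic[OF j(1)])
  also have "(\<Sum>i=1..<j. 1 / real i) \<le> (\<Sum>i\<in>sifted {} (real j). 1 / real i)"
    by (intro sum_mono2) (auto simp: sifted_empty)
  also have "\<dots> \<le> 1 + ln (real j)" using j(1) by (intro harmonic_bounds(2)) simp
  also have "ln (real j) \<le> ln (4 * ln y)"
  proof -
    have "(1::real) / 2 \<le> ln 2"
      using ln_le_minus_one[of "1 / 2 :: real"] by (simp add: ln_div)
    moreover have "ln y > 0" using assms by simp
    ultimately have "2 * (ln y / ln 2) \<le> 4 * ln y" by (simp add: field_simps)
    then show ?thesis using j by (intro ln_mono) (auto simp: log_def)
  qed
  also have "\<dots> = 2 * ln 2 + ln (ln y)"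
  proof -
    have "ln (4::real) = ln (2 ^ 2)" by simp
    also have "\<dots> = 2 * ln 2" by (subst ln_realpow) auto
    finally show ?thesis using assms by (simp add: ln_mult)
  qed
  finally show ?thesis using ln_2_less_1 by simp
qed

text \<open>Factor by factor, from \<open>exp (- 2 * u) \<le> 1 - u\<close> for
  \<open>0 \<le> u \<le> 1 / 2\<close>.\<close>

lemma sieve_density_ge:
  assumes "\<forall>p\<in>D. prime p"
  shows "exp (- 2 * (\<Sum>p\<in>D. 1 / real p)) \<le> sieve_density D"
proof -
  have "exp (- 2 * (\<Sum>p\<in>D. 1 / real p)) \<le> (\<Prod>p\<in>D. exp (- 2 / real p))"
  proof (cases "finite D")
    case True
    then show ?thesis by (simp add: exp_sum [symmetric] sum_distrib_left)
  qed simp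
  also have "\<dots> \<le> sieve_density D"
    unfolding sieve_density_def
  proof (intro prod_mono conjI)
    fix p assume "p \<in> D"
    then have p: "real p \<ge> 2" using assms prime_ge_2_nat[of p] by auto
    define u where "u = 1 / real p"
    have u: "0 \<le> u" "u \<le> 1 / 2" using p by (auto simp: u_def field_simps)
    have "- 2 * u \<le> - u - 2 * u\<^sup>2" using u mult_left_mono[OF u(2) u(1)] by (simp add: power2_eq_square)
    also have "\<dots> \<le> ln (1 - u)" using u by (intro ln_one_minus_pos_lower_bound)
    finally have "exp (- 2 * u) \<le> exp (ln (1 - u))" by (simp only: exp_le_cancel_iff)
    also have "\<dots> = 1 - u" using u by (intro exp_ln) auto
    finally show "exp (- 2 / real p) \<le> 1 - 1 / real p" by (simp add: u_def)
  qed auto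
  finally show ?thesis .
qed

section \<open>The primes to be sifted out: their density and their number\<close>

definition sieving_primes :: "nat \<Rightarrow> nat \<Rightarrow> nat set" where
  "sieving_primes z q = {p. prime p \<and> (p \<le> z \<or> p dvd q)}"

lemma finite_sieving_primes: "q > 0 \<Longrightarrow> finite (sieving_primes z q)"
  by (rule finite_subset[of _ "{..z} \<union> {p. p dvd q}"]) (auto simp: sieving_primes_def)

text \<open>With \<open>L = ln q\<close>, the primes up to \<open>L\<close> have reciprocal sum at
  most \<open>7 + 2 * ln (ln L)\<close>. Those beyond \<open>L\<close> all divide \<open>q\<close>;
  there are at most \<open>L / ln L \<le> L\<close> of them, contributing at most 1. Doubling in the
  exponential yields 16 and 4.\<close>

lemma sieve_density_sieving_primes:
  assumes q: "q > 0" "ln (real q) \<ge> real z" "ln (real q) \<ge> 2" "ln (ln (real q)) \<ge> 1"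
  shows "sieve_density (sieving_primes z q) \<ge> exp (- 16) / ln (ln (real q)) ^ 4"
proof -
  define L where "L = ln (real q)"
  have L0: "L > 0" using q(3) unfolding L_def by linarith
  let ?A = "{p. prime p \<and> real p \<le> L}" and ?B = "{p. prime p \<and> p dvd q \<and> L < real p}"
  have fin: "finite ?A" "finite ?B"
    using q by (auto intro!: finite_subset[OF _ finite_divisors_nat[of q]]
        finite_subset[of ?A "{..nat \<lfloor>L\<rfloor>}"] simp: le_nat_floor)
  have "(\<Sum>p\<in>sieving_primes z q. 1 / real p) \<le> (\<Sum>p\<in>?A \<union> ?B. 1 / real p)"
    using fin q by (intro sum_mono2) (auto simp: sieving_primes_def L_def)
  also have "\<dots> = (\<Sum>p\<in>?A. 1 / real p) + (\<Sum>p\<in>?B. 1 / real p)"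
    using fin by (intro sum.union_disjoint) auto
  also have "(\<Sum>p\<in>?B. 1 / real p) \<le> (\<Sum>p\<in>?B. 1 / L)"
    using L0 by (intro sum_mono frac_le) auto
  also have "\<dots> = real (card ?B) / L" by simp
  also have "\<dots> \<le> 1"
  proof -
    have "real (card ?B) * 1 \<le> real (card ?B) * ln L" using q by (intro mult_left_mono) (auto simp: L_def)
    also have "\<dots> \<le> L" using card_large_prime_divisors[OF q(1), of L] q(3) by (simp add: L_def)
    finally show ?thesis using L0 by (simp add: divide_le_eq_1)
  qed
  also have "(\<Sum>p\<in>?A. 1 / real p) \<le> 7 + 2 * ln (ln L)" using q by (intro sum_primes_le) (auto simp: L_def)
  finally have S: "(\<Sum>p\<in>sieving_primes z q. 1 / real p) \<le> 8 + 2 * ln (ln L)" by simp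
  have LL: "ln L > 0" using q by (simp add: L_def)
  have "exp (- 16) / ln L ^ 4 = exp (- 16) / exp (ln (ln L ^ 4))" using LL by simp
  also have "\<dots> = exp (- 2 * (8 + 2 * ln (ln L)))"
    using LL by (simp add: ln_realpow exp_diff [symmetric])
  also have "\<dots> \<le> exp (- 2 * (\<Sum>p\<in>sieving_primes z q. 1 / real p))" using S by simp
  also have "\<dots> \<le> sieve_density (sieving_primes z q)"
    by (rule sieve_density_ge) (simp add: sieving_primes_def)
  finally show ?thesis by (simp add: L_def)
qed

text \<open>Up to the free cut \<open>y\<close> all integers are counted, beyond it only prime
  divisors of \<open>q\<close>, whose product is at most \<open>q\<close>. The later choice is
  \<open>y = L powr (9 / 10)\<close> with \<open>L = ln q\<close>.\<close>

lemma card_sieving_primes: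
  assumes q: "q > 0" "y > 1"
  shows "real (card (sieving_primes z q)) \<le> real z + y + ln (real q) / ln y"
proof -
  let ?B = "{p. prime p \<and> p dvd q \<and> y < real p}"
  have fin: "finite ?B" using q by (intro finite_subset[OF _ finite_divisors_nat[of q]]) auto
  have "sieving_primes z q \<subseteq> ({1..z} \<union> {1..nat \<lfloor>y\<rfloor>}) \<union> ?B"
    by (auto simp: sieving_primes_def Suc_le_eq prime_gt_0_nat) (meson le_nat_floor not_le)
  then have "card (sieving_primes z q) \<le> card (({1..z} \<union> {1..nat \<lfloor>y\<rfloor>}) \<union> ?B)"
    using fin by (intro card_mono) auto
  also have "\<dots> \<le> z + nat \<lfloor>y\<rfloor> + card ?B"
    using card_Un_le[of "{1..z} \<union> {1..nat \<lfloor>y\<rfloor>}" ?B] card_Un_le[of "{1..z}" "{1..nat \<lfloor>y\<rfloor>}"] by simp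
  finally have "real (card (sieving_primes z q)) \<le> real (z + nat \<lfloor>y\<rfloor> + card ?B)"
    by (simp only: of_nat_le_iff)
  also have "\<dots> \<le> real z + y + card ?B" using q by simp
  also have "real (card ?B) \<le> ln (real q) / ln y"
    using card_large_prime_divisors[OF q] q by (simp add: field_simps)
  finally show ?thesis by simp
qed

section \<open>The moment inequality\<close>

definition num_reps :: "nat set \<Rightarrow> nat \<Rightarrow> nat \<Rightarrow> nat" where
  "num_reps A k N = card {g \<in> {..<k} \<rightarrow>\<^sub>E A. prod g {..<k} = N}"

lemma prod_sifted:
  assumes "\<forall>p\<in>D. prime p" "g \<in> {..<k} \<rightarrow>\<^sub>E sifted D x"
  shows "prod g {..<k} \<in> sifted D (x ^ k)"
proof -
  have g: "g i \<in> sifted D x" if "i < k" for i using assms(2) that by auto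
  have "(\<Prod>i<k. real (g i)) \<le> (\<Prod>i<k. x)"
    using g by (intro prod_mono) (auto simp: sifted_def)
  then have "real (prod g {..<k}) \<le> x ^ k" by simp
  moreover have "prod g {..<k} > 0" using g by (intro prod_pos) (auto simp: sifted_def)
  moreover have "\<not> p dvd prod g {..<k}" if "p \<in> D" for p
    using that assms(1) g by (subst prime_dvd_prod_iff) (auto simp: sifted_def)
  ultimately show ?thesis unfolding sifted_def by simp
qed

text \<open>The generality of a semiring allows one expansion to serve both the real weight and the
  complex characters, with the same coefficients \<open>num_reps\<close>.\<close>

lemma sum_sifted_power:
  fixes f :: "nat \<Rightarrow> 'a :: comm_semiring_1"
  assumes f: "f 1 = 1" "\<And>m n. f (m * n) = f m * f n" and D: "\<forall>p\<in>D. prime p"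
  shows "(\<Sum>n\<in>sifted D x. f n) ^ k = (\<Sum>N\<in>sifted D (x ^ k). of_nat (num_reps (sifted D x) k N) * f N)"
proof -
  let ?\<Gamma> = "{..<k} \<rightarrow>\<^sub>E sifted D x"
  have fin: "finite ?\<Gamma>" by (intro finite_PiE) auto
  have f_prod: "f (prod g A) = (\<Prod>i\<in>A. f (g i))" if "finite A" for g :: "nat \<Rightarrow> nat" and A
    using that f by (induction A rule: finite_induct) auto
  have "(\<Sum>n\<in>sifted D x. f n) ^ k = (\<Prod>i<k. \<Sum>n\<in>sifted D x. f n)" by simp
  also have "\<dots> = (\<Sum>g\<in>?\<Gamma>. \<Prod>i<k. f (g i))" by (rule prod_sum_PiE) auto
  also have "\<dots> = (\<Sum>g\<in>?\<Gamma>. f (prod g {..<k}))" by (simp add: f_prod)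
  also have "\<dots> = (\<Sum>N\<in>sifted D (x ^ k). \<Sum>g\<in>{g \<in> ?\<Gamma>. prod g {..<k} = N}. f (prod g {..<k}))"
    using prod_sifted[OF D] fin by (intro sum.group [symmetric]) auto
  also have "\<dots> = (\<Sum>N\<in>sifted D (x ^ k). of_nat (num_reps (sifted D x) k N) * f N)"
    by (intro sum.cong refl) (simp add: num_reps_def)
  finally show ?thesis .
qed

lemma Cauchy_Schwarz_sum:
  fixes a b :: "'b \<Rightarrow> real"
  shows "(\<Sum>i\<in>I. a i * b i)\<^sup>2 \<le> (\<Sum>i\<in>I. (a i)\<^sup>2) * (\<Sum>i\<in>I. (b i)\<^sup>2)"
proof (cases "finite I \<and> (\<Sum>i\<in>I. (b i)\<^sup>2) \<noteq> 0")
  case True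
  define A B C where "A = (\<Sum>i\<in>I. (a i)\<^sup>2)" and "B = (\<Sum>i\<in>I. (b i)\<^sup>2)" and "C = (\<Sum>i\<in>I. a i * b i)"
  have "B \<ge> 0" unfolding B_def by (intro sum_nonneg) auto
  then have B: "B > 0" using True unfolding B_def by linarith
  have "0 \<le> (\<Sum>i\<in>I. (B * a i - C * b i)\<^sup>2)" by (intro sum_nonneg) auto
  also have "\<dots> = (\<Sum>i\<in>I. B\<^sup>2 * (a i)\<^sup>2 - 2 * B * C * (a i * b i) + C\<^sup>2 * (b i)\<^sup>2)"
    by (intro sum.cong refl) (simp add: power2_eq_square algebra_simps)
  also have "\<dots> = B\<^sup>2 * A - 2 * B * C * C + C\<^sup>2 * B"
    by (simp add: sum.distrib sum_subtractf A_def B_def C_def sum_distrib_left)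
  also have "\<dots> = B * (A * B - C\<^sup>2)" by (simp add: power2_eq_square algebra_simps)
  finally show ?thesis using B by (simp add: zero_le_mult_iff A_def B_def C_def)
next
  case False
  then have "(\<Sum>i\<in>I. a i * b i) = 0"
    by (cases "finite I") (auto simp: sum_nonneg_eq_0_iff)
  then show ?thesis by (simp add: sum_nonneg)
qed

lemma coprime_iff_prime_factors:
  assumes "(q::nat) > 0"
  shows "coprime n q \<longleftrightarrow> (\<forall>p\<in>prime_factors q. \<not> p dvd n)"
proof (rule iffI)
  assume *: "coprime n q"
  show "\<forall>p\<in>prime_factors q. \<not> p dvd n"
  proof (intro ballI notI)
    fix p assume p: "p \<in> prime_factors q" "p dvd n"
    then have "is_unit p" using * by (intro coprime_common_divisor[of n q]) (auto simp: in_prime_factors_iff)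
    moreover have "prime p" using p(1) by (rule in_prime_factors_imp_prime)
    ultimately show False by simp
  qed
next
  assume *: "\<forall>p\<in>prime_factors q. \<not> p dvd n"
  show "coprime n q"
  proof (rule ccontr)
    assume "\<not> coprime n q"
    then have "gcd n q \<noteq> 1" using coprime_iff_gcd_eq_1 by blast
    then obtain p where p: "prime p" "p dvd gcd n q" using prime_factor_nat by blast
    then have "p dvd n" "p \<in> prime_factors q" using assms by (simp_all add: in_prime_factors_iff)
    then show False using * by blast
  qed
qed

text \<open>Positivity of the remaining sum excludes \<open>X = {a}\<close> and permits division by
  \<open>card X\<close> instead of \<open>card X - 1\<close>; in the applications this is
  \<open>totient q\<close>.\<close>

lemma exists_ge_average:
  fixes g :: "'b \<Rightarrow> real"
  assumes "finite X" "a \<in> X" "\<And>y. y \<in> X \<Longrightarrow> g y \<ge> 0" "sum g X - g a > 0"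
  shows "\<exists>y\<in>X. y \<noteq> a \<and> g y \<ge> (sum g X - g a) / card X"
proof (rule ccontr)
  define M where "M = (sum g X - g a) / card X"
  assume "\<not> (\<exists>y\<in>X. y \<noteq> a \<and> g y \<ge> (sum g X - g a) / card X)"
  then have "\<not> M \<le> g y" if "y \<in> X" "y \<noteq> a" for y using that unfolding M_def by blast
  then have *: "g y \<le> M" if "y \<in> X - {a}" for y using that by (simp add: not_le less_imp_le)
  have cX: "card X > 0" using assms(1,2) by (auto simp: card_gt_0_iff)
  then have M: "M > 0" using assms(4) by (simp add: M_def)
  have "sum g X - g a = sum g (X - {a})" using assms(1,2) by (simp add: sum.remove)
  also have "\<dots> \<le> (\<Sum>y\<in>X - {a}. M)" using * by (rule sum_mono)
  also have "\<dots> = (real (card X) - 1) * M" using assms(1,2) cX by (simp add: of_nat_diff)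
  also have "\<dots> < real (card X) * M" using M by simp
  also have "\<dots> = sum g X - g a" using cX by (simp add: M_def)
  finally show False by simp
qed

lemma sifted_prime_factors_subset:
  assumes "q > 0" "y < real q"
  shows "sifted (prime_factors q) y \<subseteq> {n. n < q \<and> coprime n q}"
  using assms by (auto simp: sifted_def coprime_iff_prime_factors)

lemma character_sum_eq_sifted:
  assumes "q > 0" "dirichlet_character q \<chi>"
  shows "(\<Sum>n | 1 \<le> n \<and> real n \<le> x. \<chi> n) = (\<Sum>n\<in>sifted (prime_factors q) x. \<chi> n)"
proof (rule sum.mono_neutral_right)
  show "finite {n. 1 \<le> n \<and> real n \<le> x}"
    by (rule finite_subset[OF _ finite_sifted[of "{}" x]]) (auto simp: sifted_def)
  show "\<forall>i\<in>{n. 1 \<le> n \<and> real n \<le> x} - sifted (prime_factors q) x. \<chi> i = 0"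
    using assms(2) coprime_iff_prime_factors[OF assms(1)] by (auto simp: sifted_def dirichlet_character_def)
qed (auto simp: sifted_def)

lemma principal_sum_sifted:
  assumes "q > 0"
  shows "(\<Sum>n\<in>sifted (prime_factors q) x. principal_character q n) = of_nat (card (sifted (prime_factors q) x))"
proof -
  have "(\<Sum>n\<in>sifted (prime_factors q) x. principal_character q n) = (\<Sum>n\<in>sifted (prime_factors q) x. 1)"
    using assms by (intro sum.cong refl)
      (auto simp: principal_character_def sifted_def coprime_iff_prime_factors)
  then show ?thesis by simp
qed

lemma card_sifted_le: "y \<ge> 0 \<Longrightarrow> real (card (sifted D y)) \<le> y"
proof -
  assume y: "y \<ge> 0"
  have "card (sifted D y) \<le> card {1..nat \<lfloor>y\<rfloor>}" by (intro card_mono sifted_subset) auto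
  then show ?thesis using y by simp linarith
qed

text \<open>Serves the moduli too small for the asymptotic estimates. The second moment leaves a
  total of \<open>card A * (totient q - card A)\<close> for the non-principal characters. This is a
  positive integer: 1 lies in \<open>A\<close>, while \<open>q - 1\<close> is coprime to
  \<open>q\<close> but exceeds \<open>x\<close>.\<close>

lemma nonprincipal_sum_ge_inverse:
  assumes q: "q \<ge> 3" and x: "1 \<le> x" "x < real q - 1"
  shows "\<exists>\<chi>. dirichlet_character q \<chi> \<and> \<chi> \<noteq> principal_character q \<and>
    (cmod (\<Sum>n | 1 \<le> n \<and> real n \<le> x. \<chi> n))\<^sup>2 \<ge> 1 / real q"
proof -
  define A where "A = sifted (prime_factors q) x"
  have sub: "A \<subseteq> {n. n < q \<and> coprime n q}"
    unfolding A_def using q x by (intro sifted_prime_factors_subset) auto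
  from dirichlet_parseval[of q A "\<lambda>_. 1"] sub q obtain X where X: "finite X" "card X = totient q"
    "principal_character q \<in> X" "\<And>\<chi>. \<chi> \<in> X \<Longrightarrow> dirichlet_character q \<chi>"
    "(\<Sum>\<chi>\<in>X. (cmod (\<Sum>N\<in>A. \<chi> N))\<^sup>2) = totient q * card A"
    by auto
  have pr: "cmod (\<Sum>N\<in>A. principal_character q N) = card A"
    using principal_sum_sifted[of q x] q by (simp add: A_def)
  have "1 \<in> A" using x by (auto simp: A_def sifted_def dest: in_prime_factors_imp_prime)
  then have A1: "card A \<ge> 1" using finite_sifted by (metis A_def One_nat_def Suc_leI card_gt_0_iff empty_iff)
  have "card (insert (q - 1) A) \<le> card (totatives q)"
  proof (intro card_mono)
    show "insert (q - 1) A \<subseteq> totatives q"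
      using sub q by (auto simp: totatives_def A_def sifted_def coprime_diff_one_left_nat[of q, unfolded One_nat_def])
  qed simp
  moreover have "q - 1 \<notin> A" using x q by (auto simp: A_def sifted_def of_nat_diff)
  ultimately have A2: "card A + 1 \<le> totient q" by (simp add: totient_def A_def)
  have "1 * 1 \<le> card A * (totient q - card A)" using A1 A2 by (intro mult_mono) auto
  then have "real 1 \<le> real (card A * (totient q - card A))" by (simp only: of_nat_le_iff)
  then have pos: "1 \<le> real (totient q) * card A - (real (card A))\<^sup>2"
    using A2 by (simp add: of_nat_diff power2_eq_square algebra_simps)
  obtain \<chi> where \<chi>: "\<chi> \<in> X" "\<chi> \<noteq> principal_character q"
    "(cmod (\<Sum>N\<in>A. \<chi> N))\<^sup>2 \<ge> (real (totient q) * card A - (real (card A))\<^sup>2) / card X"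
    using exists_ge_average[OF X(1,3), of "\<lambda>\<chi>. (cmod (\<Sum>N\<in>A. \<chi> N))\<^sup>2"] X(5) pr pos by auto
  have tq: "0 < totient q" "totient q \<le> q" using q totient_le by auto
  have "1 / real q \<le> (real (totient q) * card A - (real (card A))\<^sup>2) / card X"
    unfolding X(2) using pos tq by (intro frac_le) auto
  with \<chi> X(4)[OF \<chi>(1)] character_sum_eq_sifted[of q \<chi> x] q show ?thesis
    by (intro exI[of _ \<chi>]) (auto simp: A_def)
qed

text \<open>The squared weight is \<open>(k ^ 2) ^ Omega N\<close>, so the upper bound over sifted
  sets is used with \<open>j = k ^ 2 - 1\<close>. This fixes the exponent in \<open>B\<close> and
  the threshold \<open>k ^ 8 = (k ^ 2) ^ 4\<close>. Coprimality to \<open>q\<close> is dropped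
  there, which an upper bound can afford.\<close>

lemma nonprincipal_moment:
  fixes k q :: nat and x :: real
  defines "V \<equiv> (\<Sum>n\<in>sifted (sieving_primes (k ^ 8) q) x. real k ^ Omega n)"
    and "B \<equiv> 3 * x ^ k * (1 + ln (x ^ k)) ^ (k\<^sup>2 - 1)"
  assumes q: "q > 1" and k: "k \<ge> 1" and x: "x \<ge> 1" "x ^ k < real q"
    and M: "V ^ (2 * k) / B - x ^ (2 * k) / totient q > 0"
  shows "\<exists>\<chi>. dirichlet_character q \<chi> \<and> \<chi> \<noteq> principal_character q \<and>
    cmod (\<Sum>n | 1 \<le> n \<and> real n \<le> x. \<chi> n) ^ (2 * k) \<ge> V ^ (2 * k) / B - x ^ (2 * k) / totient q"
proof -
  define Q where "Q = prime_factors q"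
  define P where "P = {p. prime p \<and> p \<le> k ^ 8}"
  define r where "r = num_reps (sifted Q x) k"
  \<comment> \<open>The condition on small primes is part of \<open>b\<close>, which stays
    completely multiplicative on all naturals with \<open>b 0 = 0\<close>. The expansion can then
    run over numbers sifted by \<open>Q\<close> alone, with the same \<open>r\<close> as for the
    characters.\<close>
  define b where "b N = (if N > 0 \<and> (\<forall>p\<in>P. \<not> p dvd N) then real k ^ Omega N else 0)" for N
  let ?T = "sifted Q (x ^ k)"
  have Q: "\<forall>p\<in>Q. prime p" by (auto simp: Q_def)
  have sub: "?T \<subseteq> {n. n < q \<and> coprime n q}"
    unfolding Q_def using q x by (intro sifted_prime_factors_subset) auto
  have xk: "x ^ k \<ge> 1" using x by simp
  then have B: "B > 0" using x by (simp add: B_def add_pos_nonneg)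
  have split: "sieving_primes (k ^ 8) q = P \<union> Q"
    using q by (auto simp: sieving_primes_def P_def Q_def in_prime_factors_iff)
  have "(\<Sum>n\<in>sifted Q x. b n) = V"
    unfolding V_def split by (rule sum.mono_neutral_cong_right) (simp, auto simp: sifted_def b_def)
  moreover have "(\<Sum>n\<in>sifted Q x. b n) ^ k = (\<Sum>N\<in>?T. real (r N) * b N)"
    unfolding r_def
  proof (rule sum_sifted_power[OF _ _ Q])
    show "b 1 = 1" by (auto simp: b_def P_def)
    show "b (m * n) = b m * b n" for m n
      by (auto simp: b_def P_def prime_dvd_mult_iff Omega_mult power_add)
  qed
  ultimately have "V ^ (2 * k) = (\<Sum>N\<in>?T. real (r N) * b N)\<^sup>2"
    by (simp add: power_even_eq)
  also have "\<dots> \<le> (\<Sum>N\<in>?T. (real (r N))\<^sup>2) * (\<Sum>N\<in>?T. (b N)\<^sup>2)"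
    by (rule Cauchy_Schwarz_sum)
  also have "\<dots> \<le> (\<Sum>N\<in>?T. (real (r N))\<^sup>2) * B"
  proof (rule mult_left_mono)
    have k2: "1 + (k\<^sup>2 - 1) = k\<^sup>2" "1 + real (k\<^sup>2 - 1) = (real k)\<^sup>2" using k by (auto simp: of_nat_diff)
    have sq: "(real k ^ m)\<^sup>2 = ((real k)\<^sup>2) ^ m" for m
      by (simp flip: power_mult add: mult.commute)
    have "(\<Sum>N\<in>?T. (b N)\<^sup>2) = (\<Sum>N\<in>sifted (P \<union> Q) (x ^ k). ((real k)\<^sup>2) ^ Omega N)"
      by (rule sum.mono_neutral_cong_right)
        (simp, auto simp: sifted_def b_def sq)
    also have "\<dots> \<le> (\<Sum>N\<in>sifted P (x ^ k). ((real k)\<^sup>2) ^ Omega N)"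
      by (rule sum_mono2) (simp, auto simp: sifted_def)
    also have "\<dots> = (\<Sum>N\<in>sifted {p. prime p \<and> p \<le> (1 + (k\<^sup>2 - 1)) ^ 4} (x ^ k). (1 + real (k\<^sup>2 - 1)) ^ Omega N)"
      unfolding k2 by (simp add: P_def flip: power_mult)
    also have "\<dots> \<le> B" unfolding B_def by (rule sum_Omega_sifted_le[OF xk])
    finally show "(\<Sum>N\<in>?T. (b N)\<^sup>2) \<le> B" .
  qed (auto intro: sum_nonneg)
  finally have VB: "V ^ (2 * k) / B \<le> (\<Sum>N\<in>?T. (real (r N))\<^sup>2)" using B by (simp add: field_simps)
  from dirichlet_parseval[OF q sub, of "\<lambda>N. of_nat (r N)"] obtain X where X: "finite X" "card X = totient q"
    "principal_character q \<in> X" "\<And>\<chi>. \<chi> \<in> X \<Longrightarrow> dirichlet_character q \<chi>"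
    "(\<Sum>\<chi>\<in>X. (cmod (\<Sum>N\<in>?T. of_nat (r N) * \<chi> N))\<^sup>2) = totient q * (\<Sum>N\<in>?T. (real (r N))\<^sup>2)"
    by auto
  let ?S = "\<lambda>\<chi>. \<Sum>n\<in>sifted Q x. \<chi> n"
  have Sk: "(cmod (\<Sum>N\<in>?T. of_nat (r N) * \<chi> N))\<^sup>2 = cmod (?S \<chi>) ^ (2 * k)" if "\<chi> \<in> X" for \<chi>
  proof -
    have "?S \<chi> ^ k = (\<Sum>N\<in>?T. of_nat (r N) * \<chi> N)"
      unfolding r_def using X(4)[OF that] by (intro sum_sifted_power[OF _ _ Q]) (auto simp: dirichlet_character_def)
    then have "(\<Sum>N\<in>?T. of_nat (r N) * \<chi> N) = ?S \<chi> ^ k" ..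
    then show ?thesis by (simp add: norm_power power_even_eq)
  qed
  have total: "(\<Sum>\<chi>\<in>X. cmod (?S \<chi>) ^ (2 * k)) = totient q * (\<Sum>N\<in>?T. (real (r N))\<^sup>2)"
    using X(5) Sk by simp
  have pr: "cmod (?S (principal_character q)) ^ (2 * k) \<le> x ^ (2 * k)"
    using principal_sum_sifted[of q x] card_sifted_le[of x Q] q x
    by (intro power_mono) (auto simp: Q_def)
  have tq: "totient q > 0" using q by simp
  have "totient q * (V ^ (2 * k) / B - x ^ (2 * k) / totient q) \<le>
      (\<Sum>\<chi>\<in>X. cmod (?S \<chi>) ^ (2 * k)) - cmod (?S (principal_character q)) ^ (2 * k)"
    using VB pr tq mult_left_mono[OF VB, of "totient q"] unfolding total by (simp add: algebra_simps)
  then have le: "V ^ (2 * k) / B - x ^ (2 * k) / totient q \<le>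
      ((\<Sum>\<chi>\<in>X. cmod (?S \<chi>) ^ (2 * k)) - cmod (?S (principal_character q)) ^ (2 * k)) / card X"
    using tq by (simp add: X(2) pos_le_divide_eq mult.commute)
  with M have "0 < ((\<Sum>\<chi>\<in>X. cmod (?S \<chi>) ^ (2 * k)) - cmod (?S (principal_character q)) ^ (2 * k)) / card X"
    by linarith
  then have "(\<Sum>\<chi>\<in>X. cmod (?S \<chi>) ^ (2 * k)) - cmod (?S (principal_character q)) ^ (2 * k) > 0"
    using tq by (simp add: X(2) zero_less_divide_iff)
  from exists_ge_average[OF X(1,3) _ this] obtain \<chi> where "\<chi> \<in> X" "\<chi> \<noteq> principal_character q"
    "cmod (?S \<chi>) ^ (2 * k) \<ge> V ^ (2 * k) / B - x ^ (2 * k) / totient q"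
    using le by force
  then show ?thesis using X(4) character_sum_eq_sifted[of q \<chi> x] q by (intro exI[of _ \<chi>]) (auto simp: Q_def)
qed

section \<open>Asymptotics\<close>

lemma ln_2_le: "ln 2 \<le> (3 / 4 :: real)"
proof -
  have "(2::real) \<le> (1 + 3 / 8 + (3 / 8)\<^sup>2 / 2)\<^sup>2" by (simp add: power2_eq_square)
  also have "\<dots> \<le> (exp (3 / 8))\<^sup>2" by (intro power_mono exp_lower_Taylor_quadratic) auto
  also have "\<dots> = exp (3 / 4)" by (simp flip: exp_double)
  finally have "ln 2 \<le> ln (exp (3 / 4 :: real))" by (intro ln_mono) auto
  then show ?thesis by simp
qed

text \<open>Amounts to \<open>exp 1 < 3\<close>, from \<open>exp (1 / 4) \<le> 21 / 16\<close>; it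
  makes \<open>ln (ln q)\<close> positive from \<open>q = 3\<close> on.\<close>

lemma one_less_ln:
  assumes "(q::real) \<ge> 3"
  shows "1 < ln q"
proof -
  have "exp (1 / 4 :: real) \<le> 1 + 1 / 4 + (1 / 4)\<^sup>2" by (rule exp_bound) auto
  then have "exp (1 / 4 :: real) ^ 4 \<le> (21 / 16) ^ 4" by (intro power_mono) (auto simp: power2_eq_square)
  also have "exp (1 / 4 :: real) ^ 4 = exp 1" by (simp flip: exp_of_nat_mult)
  also have "(21 / 16 :: real) ^ 4 < 3" by (simp add: power_numeral_reduce)
  finally have "exp 1 < q" using assms by simp
  then have "ln (exp 1) < ln q" using assms by (intro ln_less_cancel_iff[THEN iffD2]) auto
  then show ?thesis by simp
qed

text \<open>What is required of \<open>L = ln q\<close>. In the fifth condition the leading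
  coefficient on the left is \<open>3 / 4 * 10 / 9 = 5 / 6\<close>, below \<open>9 / 10\<close>,
  with \<open>3 / 4\<close> replacing \<open>ln 2\<close>. The sixth controls the principal
  character.\<close>

lemma asymptotic_conditions:
  fixes z :: real and c :: real and n :: nat
  assumes "c > 0"
  shows "\<forall>\<^sub>F L in at_top. L \<ge> z" "\<forall>\<^sub>F L in at_top. L \<ge> (2::real)"
    "\<forall>\<^sub>F L in at_top. ln L \<ge> (1::real)"
    "\<forall>\<^sub>F L in at_top. L / ln L \<ge> (1::real)"
    "\<forall>\<^sub>F L in at_top. 3 / 4 * (1 + (z + L powr (9 / 10) + L / (9 / 10 * ln L))) + 16 + 4 * ln (ln L)
       \<le> 9 / 10 * (L / ln L)"
    "\<forall>\<^sub>F L in at_top. 2 * exp 16 * ln L ^ n \<le> c * L"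
  using assms by real_asymp+


lemma powr_le_of_le_power:
  fixes u w :: real
  assumes "u \<ge> 0" "w > 0" "n > 0" "w \<le> u ^ n"
  shows "w powr (1 / n) \<le> u"
proof -
  have "(w powr (1 / n)) ^ n = w"
    using assms by (simp add: powr_realpow [symmetric] powr_powr)
  then show ?thesis using assms by (metis power_mono_iff powr_ge_zero)
qed

text \<open>The sieve bound for \<open>V\<close> is applied with \<open>t = x\<^bsup>1/(10k)\<^esup>\<close>; since \<open>q\<close> has at most
  \<open>(10/9 + o(1)) ln q / ln (ln q)\<close> prime factors and \<open>10/9 \<sqdot> ln 2 < 9/10\<close>, the error term
  \<open>2\<^bsup>|D|\<^esup>\<close> is smaller than \<open>x\<^bsup>9/10\<^esup>\<close>.\<close>

lemma sum_Omega_sieving_ge: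
  fixes k q z :: nat and x :: real
  defines "L \<equiv> ln (real q)"
  defines "\<rho> \<equiv> sieve_density (sieving_primes z q)"
  assumes k: "k \<ge> 1" and q: "q > 0" and x: "exp (L / ln L) \<le> x"
    and L: "L \<ge> 2" "ln L \<ge> 1" "\<rho> \<ge> exp (- 16) / ln L ^ 4"
    and main: "3 / 4 * (1 + (real z + L powr (9 / 10) + L / (9 / 10 * ln L))) + 16 + 4 * ln (ln L)
       \<le> 9 / 10 * (L / ln L)"
  shows "(\<Sum>n\<in>sifted (sieving_primes z q) x. real k ^ Omega n) \<ge>
    \<rho> / 2 * x * (\<rho> * (ln x / (10 * k))) ^ (k - 1)"
proof -
  define D where "D = sieving_primes z q"
  have D: "finite D" "\<forall>p\<in>D. prime p"
    using finite_sieving_primes[OF q] by (auto simp: D_def sieving_primes_def)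
  have \<rho>: "\<rho> > 0" unfolding \<rho>_def D_def [symmetric] using D(2) by (rule sieve_density_pos)
  have xpos: "x > 0" using x by (meson exp_gt_zero less_le_trans)
  have "ln (exp (L / ln L)) \<le> ln x" using x xpos by (intro ln_mono) auto
  then have lx: "L / ln L \<le> ln x" by simp
  have lx0: "ln x > 0" using lx L by (meson divide_pos_pos less_le_trans zero_less_numeral zero_less_one)
  define t where "t = x powr (1 / (10 * k))"
  have lt: "ln t = ln x / (10 * k)" using xpos by (simp add: t_def ln_powr)
  have t0: "t > 0" using xpos by (simp add: t_def)
  have t: "t \<ge> 1"
    using t0 lt lx0 by (metis divide_nonneg_nonneg less_imp_le ln_ge_zero_iff of_nat_0_le_iff)
  have "t ^ (k - 1) * (2 * 2 ^ card D / \<rho>) \<le> x"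
  proof -
    have ln_eq: "ln (t ^ (k - 1) * (2 * 2 ^ card D / \<rho>)) = real (k - 1) * ln t + (1 + real (card D)) * ln 2 - ln \<rho>"
      using t0 \<rho> by (simp add: ln_mult ln_div ln_realpow algebra_simps)
    have "real (k - 1) * ln t \<le> real k * ln t" using t k by (intro mult_right_mono) auto
    also have "real k * ln t = ln x / 10" using k by (simp add: lt)
    finally have ln_t: "real (k - 1) * ln t \<le> ln x / 10" .
    have ln_D: "(1 + real (card D)) * ln 2 \<le> (1 + (real z + L powr (9 / 10) + L / (9 / 10 * ln L))) * (3 / 4)"
    proof (intro mult_mono)
      have "1 < L powr (9 / 10)" using L by (intro gr_one_powr) auto
      from card_sieving_primes[OF q this, of z]
      show "1 + real (card D) \<le> 1 + (real z + L powr (9 / 10) + L / (9 / 10 * ln L))"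
        using L by (simp add: D_def ln_powr L_def)
    qed (use ln_2_le L in auto)
    have "- ln \<rho> \<le> 16 + 4 * ln (ln L)"
    proof -
      have "ln (exp (- 16) / ln L ^ 4) \<le> ln \<rho>" using L \<rho> by (intro ln_mono) auto
      then show ?thesis using L by (simp add: ln_div ln_realpow)
    qed
    \<comment> \<open>The budget in logarithms: \<open>t ^ (k - 1)\<close> takes a tenth of
      \<open>ln x\<close>, and by \<open>main\<close> the other nine tenths cover the sieve error
      and \<open>- ln \<rho>\<close>.\<close>
    moreover have "A \<le> l"
      if "A = a + b - c" "a \<le> l / 10" "b \<le> (1 + W) * (3 / 4)" "3 / 4 * (1 + W) + 16 + E \<le> 9 / 10 * m"
        "m \<le> l" "- c \<le> 16 + E" for A a b c l m E W :: real
      using that by argo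
    ultimately have "ln (t ^ (k - 1) * (2 * 2 ^ card D / \<rho>)) \<le> ln x"
      using ln_eq ln_t ln_D main lx by blast
    moreover have "t ^ (k - 1) * (2 * 2 ^ card D / \<rho>) > 0" using t0 \<rho> by simp
    ultimately show ?thesis using xpos by simp
  qed
  then have "\<rho> / 2 * x * (\<rho> * ln t) ^ (k - 1) \<le> (\<Sum>n\<in>sifted D x. (1 + real (k - 1)) ^ Omega n)"
    unfolding \<rho>_def D_def by (intro sum_Omega_sifted_ge D[unfolded D_def] t)
  moreover have "1 + real (k - 1) = real k" using k by simp
  ultimately show ?thesis by (simp add: lt D_def)
qed

text \<open>The numerator collects the constants of the lower bound for \<open>V\<close>, raised to
  the power \<open>2 * k\<close>; the denominator those of the weight bound, after
  \<open>1 + ln (x ^ k) \<le> 2 * k * ln x\<close>.\<close>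

definition moment_const :: "nat \<Rightarrow> real" where
  "moment_const k = (1 / 2 * (1 / (10 * real k)) ^ (k - 1)) ^ (2 * k) / (3 * (2 * real k) ^ (k\<^sup>2 - 1))"

text \<open>The exponent of \<open>ln x\<close> is
  \<open>2 * k * (k - 1) - (k ^ 2 - 1) = (k - 1) ^ 2\<close>, which is where the exponent of the
  theorem originates.\<close>

lemma moment_ratio_ge:
  fixes k :: nat and x \<rho> V :: real
  assumes k: "k \<ge> 1" and x: "x > 0" "ln x \<ge> 1" and \<rho>: "\<rho> > 0"
    and V: "V \<ge> \<rho> / 2 * x * (\<rho> * (ln x / (10 * k))) ^ (k - 1)"
  shows "V ^ (2 * k) / (3 * x ^ k * (1 + ln (x ^ k)) ^ (k\<^sup>2 - 1)) \<ge>
    moment_const k * \<rho> ^ (2 * k\<^sup>2) * x ^ k * ln x ^ (k - 1)\<^sup>2"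
proof -
  define a l where "a = 1 / 2 * (1 / (10 * real k)) ^ (k - 1)" and "l = ln x"
  have l: "l \<ge> 1" using x by (simp add: l_def)
  have k1: "\<rho> * \<rho> ^ (k - 1) = \<rho> ^ k" using k by (cases k) auto
  have "(\<rho> * (l / (10 * k))) ^ (k - 1) = \<rho> ^ (k - 1) * (1 / (10 * real k)) ^ (k - 1) * l ^ (k - 1)"
    by (simp add: power_mult_distrib [symmetric])
  then have eq: "\<rho> / 2 * x * (\<rho> * (l / (10 * k))) ^ (k - 1) = a * \<rho> ^ k * x * l ^ (k - 1)"
    unfolding a_def k1 [symmetric] by simp
  have pos: "a > 0" "a * \<rho> ^ k * x * l ^ (k - 1) > 0" using k \<rho> x l by (auto simp: a_def)
  have e1: "2 * k\<^sup>2 = k * (2 * k)" by (simp add: power2_eq_square)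
  have e2: "x ^ (2 * k) = x ^ k * x ^ k" by (simp add: mult_2 power_add)
  have e3: "(k - 1) * (2 * k) = (k - 1)\<^sup>2 + (k\<^sup>2 - 1)"
    using k by (cases k) (auto simp: power2_eq_square)
  have pw: "(a * \<rho> ^ k * x * l ^ (k - 1)) ^ (2 * k) =
      a ^ (2 * k) * \<rho> ^ (2 * k\<^sup>2) * (x ^ k * x ^ k) * (l ^ (k - 1)\<^sup>2 * l ^ (k\<^sup>2 - 1))"
    unfolding power_mult_distrib e1 e2 [symmetric] power_mult [symmetric] e3 power_add by simp
  have "a * \<rho> ^ k * x * l ^ (k - 1) \<le> V" using V[folded l_def] unfolding eq .
  then have num: "V ^ (2 * k) \<ge> a ^ (2 * k) * \<rho> ^ (2 * k\<^sup>2) * (x ^ k * x ^ k) * (l ^ (k - 1)\<^sup>2 * l ^ (k\<^sup>2 - 1))"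
    using power_mono[OF _ less_imp_le[OF pos(2)], of V "2 * k"] unfolding pw by blast
  have "1 + ln (x ^ k) \<le> 2 * real k * l"
  proof -
    have "1 * 1 \<le> real k * l" using k l by (intro mult_mono) auto
    then show ?thesis using x by (simp add: ln_realpow l_def)
  qed
  moreover have lnxk: "ln (x ^ k) \<ge> 0"
  proof -
    have "ln x \<ge> 0" using x(2) by linarith
    then show ?thesis using x(1) by (simp add: ln_realpow)
  qed
  ultimately have "(1 + ln (x ^ k)) ^ (k\<^sup>2 - 1) \<le> (2 * real k) ^ (k\<^sup>2 - 1) * l ^ (k\<^sup>2 - 1)"
    unfolding power_mult_distrib [symmetric] by (intro power_mono) auto
  then have den: "3 * x ^ k * (1 + ln (x ^ k)) ^ (k\<^sup>2 - 1) \<le>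
      3 * x ^ k * ((2 * real k) ^ (k\<^sup>2 - 1) * l ^ (k\<^sup>2 - 1))"
    using x by (intro mult_left_mono) auto
  have den0: "3 * x ^ k * (1 + ln (x ^ k)) ^ (k\<^sup>2 - 1) > 0"
    using x lnxk by (intro mult_pos_pos zero_less_power add_pos_nonneg) auto
  have "moment_const k * \<rho> ^ (2 * k\<^sup>2) * x ^ k * l ^ (k - 1)\<^sup>2 =
      a ^ (2 * k) * \<rho> ^ (2 * k\<^sup>2) * (x ^ k * x ^ k) * (l ^ (k - 1)\<^sup>2 * l ^ (k\<^sup>2 - 1)) /
      (3 * x ^ k * ((2 * real k) ^ (k\<^sup>2 - 1) * l ^ (k\<^sup>2 - 1)))"
    unfolding moment_const_def a_def [symmetric] using x l k by simp
  also have "\<dots> \<le> V ^ (2 * k) / (3 * x ^ k * (1 + ln (x ^ k)) ^ (k\<^sup>2 - 1))"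
    using num den den0 pos \<rho> x l by (intro frac_le) (auto intro: order_trans[rotated])
  finally show ?thesis by (simp add: l_def)
qed

text \<open>The ratio of \<open>totient q\<close> to \<open>q\<close> is the density for the prime
  factors of \<open>q\<close>, and sifting by further primes only lowers a density.\<close>

lemma totient_ge:
  assumes "q > 0"
  shows "real (totient q) \<ge> real q * sieve_density (sieving_primes z q)"
proof -
  have "sieve_density (sieving_primes z q) \<le> sieve_density (prime_factors q)"
  proof -
    have sub: "prime_factors q \<subseteq> sieving_primes z q"
      by (auto simp: sieving_primes_def in_prime_factors_iff)
    have pr: "\<forall>p\<in>sieving_primes z q. prime p" by (simp add: sieving_primes_def)
    have "sieve_density (sieving_primes z q) =
        sieve_density (sieving_primes z q - prime_factors q) * sieve_density (prime_factors q)"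
      unfolding sieve_density_def by (rule prod.subset_diff[OF sub finite_sieving_primes[OF assms]])
    also have "\<dots> \<le> 1 * sieve_density (prime_factors q)"
    proof (intro mult_right_mono sieve_density_le_1)
      have "sieve_density (prime_factors q) > 0" by (rule sieve_density_pos) auto
      then show "0 \<le> sieve_density (prime_factors q)" by simp
    qed (use pr in auto)
    finally show ?thesis by simp
  qed
  then show ?thesis by (simp add: totient_formula2 sieve_density_def mult_left_mono)
qed

text \<open>In \<open>a\<close>, the part \<open>8 * k\<^sup>2\<close> comes from
  \<open>\<rho> ^ (2 * k\<^sup>2)\<close> with \<open>\<rho> \<ge> exp (- 16) / ln L ^ 4\<close>,
  which also explains the 32 in \<open>c\<close>; the part \<open>(k - 1)\<^sup>2\<close> comes from
  \<open>ln x \<ge> L / ln L\<close>.\<close>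

lemma large_character_sum:
  fixes k q :: nat and x :: real
  defines "L \<equiv> ln (real q)"
  defines "c \<equiv> moment_const k * exp (- 32 * real (k\<^sup>2))"
  defines "a \<equiv> 8 * k\<^sup>2 + (k - 1)\<^sup>2"
  assumes k: "k \<ge> 2" and q: "q > 0"
    and x: "exp (L / ln L) \<le> x" "x < real q powr (1 / real k)"
    and L: "L \<ge> real (k ^ 8)" "L \<ge> 2" "ln L \<ge> 1" "L / ln L \<ge> 1"
    and main: "3 / 4 * (1 + (real (k ^ 8) + L powr (9 / 10) + L / (9 / 10 * ln L))) + 16 + 4 * ln (ln L)
       \<le> 9 / 10 * (L / ln L)"
    and small: "2 * exp 16 * ln L ^ (a + 4) \<le> c * L"
  shows "\<exists>\<chi>. dirichlet_character q \<chi> \<and> \<chi> \<noteq> principal_character q \<and>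
    (c / 2) powr (1 / (2 * real k)) * L powr ((real k - 1)\<^sup>2 / (2 * real k)) *
      ln L powr (- real a / (2 * real k))
    \<le> 1 / sqrt x * cmod (\<Sum>n | 1 \<le> n \<and> real n \<le> x. \<chi> n)"
proof -
  define \<rho> where "\<rho> = sieve_density (sieving_primes (k ^ 8) q)"
  define V where "V = (\<Sum>n\<in>sifted (sieving_primes (k ^ 8) q) x. real k ^ Omega n)"
  define B where "B = 3 * x ^ k * (1 + ln (x ^ k)) ^ (k\<^sup>2 - 1)"
  define Z where "Z = c * L ^ (k - 1)\<^sup>2 / ln L ^ a"
  have k1: "k \<ge> 1" using k by simp
  have c: "c > 0" using k by (simp add: c_def moment_const_def)
  have \<rho>_ge: "\<rho> \<ge> exp (- 16) / ln L ^ 4"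
    unfolding \<rho>_def L_def using L q by (intro sieve_density_sieving_primes) (auto simp: L_def)
  have r0: "exp (- 16) / ln L ^ 4 > 0" using L by simp
  then have \<rho>: "\<rho> > 0" using \<rho>_ge by linarith
  have xpos: "x > 0" using x(1) by (meson exp_gt_zero less_le_trans)
  have "ln (exp (L / ln L)) \<le> ln x" using x xpos by (intro ln_mono) auto
  then have lx: "L / ln L \<le> ln x" by simp
  then have lx1: "ln x \<ge> 1" using L by linarith
  then have x1: "x \<ge> 1" using xpos by (metis ln_ge_zero_iff order_trans zero_le_one)
  have q1: "q > 1" using L(2) q by (cases "q = 1") (auto simp: L_def)
  have "x ^ k < (real q powr (1 / real k)) ^ k" using x xpos k by (intro power_strict_mono) auto
  also have "\<dots> = real q" using q k by (simp add: powr_realpow [symmetric] powr_powr)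
  finally have xk: "x ^ k < real q" .
  have "V \<ge> \<rho> / 2 * x * (\<rho> * (ln x / (10 * k))) ^ (k - 1)"
    unfolding V_def \<rho>_def
    using k1 q x(1) L \<rho>_ge main by (intro sum_Omega_sieving_ge) (auto simp: L_def \<rho>_def)
  then have "V ^ (2 * k) / B \<ge> moment_const k * \<rho> ^ (2 * k\<^sup>2) * x ^ k * ln x ^ (k - 1)\<^sup>2"
    unfolding B_def using k1 xpos lx1 \<rho> by (intro moment_ratio_ge)
  moreover have "moment_const k * \<rho> ^ (2 * k\<^sup>2) * x ^ k * ln x ^ (k - 1)\<^sup>2 \<ge>
      moment_const k * (exp (- 16) / ln L ^ 4) ^ (2 * k\<^sup>2) * x ^ k * (L / ln L) ^ (k - 1)\<^sup>2"
    using \<rho>_ge r0 lx L xpos by (intro mult_mono power_mono) (auto simp: moment_const_def)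
  moreover have "moment_const k * (exp (- 16) / ln L ^ 4) ^ (2 * k\<^sup>2) * x ^ k * (L / ln L) ^ (k - 1)\<^sup>2 = x ^ k * Z"
  proof -
    have "exp (- 16 :: real) ^ (2 * k\<^sup>2) = exp (- 32 * real (k\<^sup>2))"
      by (simp flip: exp_of_nat_mult)
    moreover have "(ln L ^ 4) ^ (2 * k\<^sup>2) * ln L ^ (k - 1)\<^sup>2 = ln L ^ a"
      by (simp add: a_def power_add flip: power_mult)
    ultimately show ?thesis
      by (simp add: Z_def c_def power_divide field_simps)
  qed
  ultimately have main_term: "V ^ (2 * k) / B \<ge> x ^ k * Z" by linarith
  \<comment> \<open>The principal character contributes at most \<open>x ^ k / \<rho>\<close>, which
    is to be at most half of \<open>x ^ k * Z\<close>. As \<open>k \<ge> 2\<close>, \<open>Z\<close>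
    contains at least one full power of \<open>L\<close>, and this beats the powers of
    \<open>ln L\<close>.\<close>
  have Z: "Z \<ge> 2 / \<rho>"
  proof -
    have "2 / \<rho> \<le> 2 / (exp (- 16) / ln L ^ 4)" using \<rho>_ge r0 by (intro frac_le) auto
    also have "\<dots> = 2 * exp 16 * ln L ^ (a + 4) / ln L ^ a"
      using L by (simp add: exp_minus field_simps power_add)
    also have "\<dots> \<le> c * L / ln L ^ a" using small L by (intro divide_right_mono) auto
    also have "\<dots> \<le> c * L ^ (k - 1)\<^sup>2 / ln L ^ a"
    proof -
      have "L ^ 1 \<le> L ^ (k - 1)\<^sup>2" using L k by (intro power_increasing) auto
      then show ?thesis using c L by (intro divide_right_mono mult_left_mono) auto
    qed
    finally show ?thesis by (simp add: Z_def)
  qed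
  have "2 / \<rho> > 0" using \<rho> by simp
  then have Z0: "Z > 0" using Z by linarith
  have "x ^ (2 * k) / totient q \<le> x ^ k * (Z / 2)"
  proof -
    have tq: "real q * \<rho> \<le> real (totient q)" unfolding \<rho>_def using q by (rule totient_ge)
    have "x ^ (2 * k) / totient q \<le> (x ^ k * real q) / (real q * \<rho>)"
      using tq \<rho> q xk xpos
      by (intro frac_le) (auto simp: mult_2 power_add intro!: mult_left_mono)
    also have "\<dots> = x ^ k * (1 / \<rho>)" using q by simp
    also have "\<dots> \<le> x ^ k * (Z / 2)" using Z xpos by (intro mult_left_mono) auto
    finally show ?thesis .
  qed
  with main_term have M: "V ^ (2 * k) / B - x ^ (2 * k) / totient q \<ge> x ^ k * (Z / 2)"
    by (simp add: algebra_simps)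
  moreover have "x ^ k * (Z / 2) > 0" using xpos Z0 by simp
  ultimately have "V ^ (2 * k) / B - x ^ (2 * k) / totient q > 0" by linarith
  from nonprincipal_moment[OF q1 k1 x1 xk this[unfolded V_def B_def]] obtain \<chi>
    where \<chi>: "dirichlet_character q \<chi>" "\<chi> \<noteq> principal_character q"
      "cmod (\<Sum>n | 1 \<le> n \<and> real n \<le> x. \<chi> n) ^ (2 * k) \<ge> V ^ (2 * k) / B - x ^ (2 * k) / totient q"
    unfolding V_def B_def by blast
  define u where "u = 1 / sqrt x * cmod (\<Sum>n | 1 \<le> n \<and> real n \<le> x. \<chi> n)"
  have "Z / 2 \<le> u ^ (2 * k)"
  proof -
    have "sqrt x ^ (2 * k) = x ^ k" using xpos by (simp add: power_mult)
    then have "u ^ (2 * k) = cmod (\<Sum>n | 1 \<le> n \<and> real n \<le> x. \<chi> n) ^ (2 * k) / x ^ k"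
      by (simp add: u_def power_divide)
    moreover have "x ^ k * (Z / 2) \<le> cmod (\<Sum>n | 1 \<le> n \<and> real n \<le> x. \<chi> n) ^ (2 * k)"
      using M \<chi>(3) by linarith
    then have "Z / 2 \<le> cmod (\<Sum>n | 1 \<le> n \<and> real n \<le> x. \<chi> n) ^ (2 * k) / x ^ k"
      using xpos by (simp add: pos_le_divide_eq mult.commute)
    ultimately show ?thesis by simp
  qed
  then have u: "(Z / 2) powr (1 / real (2 * k)) \<le> u"
    using Z0 k xpos by (intro powr_le_of_le_power) (auto simp: u_def)
  have Z_eq: "Z / 2 = (c / 2) * L powr ((real k - 1)\<^sup>2) * ln L powr (- real a)"
  proof -
    have "(real k - 1)\<^sup>2 = real ((k - 1)\<^sup>2)" using k by (simp add: of_nat_diff)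
    then have "L powr ((real k - 1)\<^sup>2) = L ^ (k - 1)\<^sup>2" using L by (simp only: powr_realpow)
    moreover have "ln L powr (- real a) = 1 / ln L ^ a"
      using L by (simp add: powr_minus_divide powr_realpow)
    ultimately show ?thesis by (simp add: Z_def)
  qed
  have powr_mult3: "(w * u * v) powr s = w powr s * u powr s * v powr s"
    if "w > 0" "u > 0" "v > 0" for w u v s :: real
    using that by (simp add: powr_mult)
  have "(Z / 2) powr (1 / real (2 * k)) = (c / 2) powr (1 / real (2 * k)) *
      (L powr ((real k - 1)\<^sup>2)) powr (1 / real (2 * k)) * (ln L powr (- real a)) powr (1 / real (2 * k))"
    unfolding Z_eq using c L by (intro powr_mult3) auto
  also have "\<dots> = (c / 2) powr (1 / (2 * real k)) *
      L powr ((real k - 1)\<^sup>2 / (2 * real k)) * ln L powr (- real a / (2 * real k))"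
    by (simp add: powr_powr)
  finally have "(Z / 2) powr (1 / real (2 * k)) = (c / 2) powr (1 / (2 * real k)) *
      L powr ((real k - 1)\<^sup>2 / (2 * real k)) * ln L powr (- real a / (2 * real k))" .
  with u \<chi> show ?thesis unfolding u_def by (intro exI[of _ \<chi>]) simp
qed

text \<open>The o(1) is a function \<open>\<epsilon>\<close> of \<open>q\<close> alone, fixed before
  \<open>x\<close>, hence uniform in \<open>x\<close>; together with \<open>c\<close> it may depend
  on \<open>k\<close>.\<close>

theorem theorem7:
  fixes k :: nat
  assumes "k \<ge> 2"
  shows "\<exists>c::real. \<exists>\<epsilon>::nat \<Rightarrow> real. c > 0 \<and> \<epsilon> \<longlonglongrightarrow> 0 \<and>
    (\<forall>(q::nat) (x::real).
       q \<ge> 3 \<longrightarrow>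
       exp (ln (real q) / ln (ln (real q))) \<le> x \<longrightarrow>
       x < real q powr (1 / real k) \<longrightarrow>
       (\<exists>\<chi>. dirichlet_character q \<chi> \<and> \<chi> \<noteq> principal_character q \<and>
          1 / sqrt x * cmod (\<Sum>n | 1 \<le> n \<and> real n \<le> x. \<chi> n)
            \<ge> c * ln (real q) powr ((real k - 1)^2 / (2 * real k) + \<epsilon> q)))"
proof -
  define C where "C = moment_const k * exp (- 32 * real (k\<^sup>2))"
  define a where "a = 8 * k\<^sup>2 + (k - 1)\<^sup>2"
  define c where "c = (C / 2) powr (1 / (2 * real k))"
  define e where "e = (real k - 1)\<^sup>2 / (2 * real k)"
  \<comment> \<open>Chosen so that \<open>L powr \<delta> q = ln L powr (- a / (2 * k))\<close> with
    \<open>L = ln q\<close>: the lost power of \<open>ln L\<close> is rewritten as an exponent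
    tending to 0.\<close>
  define \<delta> :: "nat \<Rightarrow> real" where
    "\<delta> q = - real a / (2 * real k) * (ln (ln (ln (real q))) / ln (ln (real q)))" for q
  define good where "good q \<longleftrightarrow> (\<forall>x. exp (ln (real q) / ln (ln (real q))) \<le> x \<longrightarrow>
       x < real q powr (1 / real k) \<longrightarrow>
       (\<exists>\<chi>. dirichlet_character q \<chi> \<and> \<chi> \<noteq> principal_character q \<and>
          1 / sqrt x * cmod (\<Sum>n | 1 \<le> n \<and> real n \<le> x. \<chi> n) \<ge> c * ln (real q) powr (e + \<delta> q)))" for q
  have C: "C > 0" using assms by (simp add: C_def moment_const_def)
  then have c: "c > 0" by (simp add: c_def)
  have lim: "filterlim (\<lambda>q. ln (real q)) at_top sequentially" by real_asymp
  note ev = asymptotic_conditions[OF C, THEN eventually_compose_filterlim[OF _ lim]]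
  have "\<forall>\<^sub>F q in sequentially. good q"
    using eventually_gt_at_top[of 0] ev(1)[of "real (k ^ 8)"] ev(2,3,4) ev(5)[of "real (k ^ 8)"] ev(6)[of "a + 4"]
  proof eventually_elim
    case (elim q)
    define L where "L = ln (real q)"
    have LL: "ln L \<ge> 1" using elim by (simp add: L_def)
    have L0: "L > 0" using elim(3) unfolding L_def by linarith
    have "L powr (e + \<delta> q) = L powr e * exp (\<delta> q * ln L)"
      using L0 by (simp add: powr_def distrib_right exp_add)
    also have "\<delta> q * ln L = - real a / (2 * real k) * ln (ln L)"
      using LL by (simp add: \<delta>_def L_def)
    also have "exp \<dots> = ln L powr (- real a / (2 * real k))" using LL by (simp add: powr_def)
    finally have eq: "c * L powr (e + \<delta> q) = c * L powr e * ln L powr (- real a / (2 * real k))" by simp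
    show "good q"
      unfolding good_def unfolding eq[unfolded L_def] unfolding c_def e_def C_def a_def
    proof (intro allI impI, goal_cases)
      case (1 x)
      show ?case by (rule large_character_sum[OF assms elim(1) 1 elim(2-6) elim(7)[unfolded C_def a_def]])
    qed
  qed
  \<comment> \<open>For the finitely many bad \<open>q\<close> the value is tuned to make the
    claimed lower bound equal to \<open>1 / q\<close>, which the second moment supplies as
    \<open>1 / sqrt q * (1 / sqrt q)\<close>.\<close>
  define \<epsilon> where "\<epsilon> q = (if good q then \<delta> q else ln (1 / (c * real q)) / ln (ln (real q)) - e)" for q
  have "\<delta> \<longlonglongrightarrow> 0" unfolding \<delta>_def by real_asymp
  moreover have "\<forall>\<^sub>F q in sequentially. \<delta> q = \<epsilon> q"
    using \<open>\<forall>\<^sub>F q in sequentially. good q\<close> by eventually_elim (simp add: \<epsilon>_def)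
  ultimately have "\<epsilon> \<longlonglongrightarrow> 0" by (rule Lim_transform_eventually)
  moreover have "\<exists>\<chi>. dirichlet_character q \<chi> \<and> \<chi> \<noteq> principal_character q \<and>
      1 / sqrt x * cmod (\<Sum>n | 1 \<le> n \<and> real n \<le> x. \<chi> n) \<ge> c * ln (real q) powr (e + \<epsilon> q)"
    if q: "q \<ge> 3" and x: "exp (ln (real q) / ln (ln (real q))) \<le> x" "x < real q powr (1 / real k)" for q x
  proof (cases "good q")
    case True
    then show ?thesis using x by (auto simp: good_def \<epsilon>_def)
  next
    case False
    define L where "L = ln (real q)"
    have L: "L > 1" using one_less_ln[of "real q"] q by (simp add: L_def)
    then have "0 \<le> L / ln L" by simp
    then have "1 \<le> exp (L / ln L)" by simp
    then have x1: "x \<ge> 1" using x(1) unfolding L_def by linarith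
    have "real q powr (1 / real k) \<le> real q powr (1 / 2)"
      using q assms by (intro powr_mono) (auto simp: frac_le)
    then have "x < sqrt (real q)" using x(2) by (simp add: powr_half_sqrt)
    also have "\<dots> \<le> real q - 1"
    proof (rule real_le_lsqrt)
      have "3 * real q \<le> real q * real q" using q by (intro mult_right_mono) auto
      moreover have "(real q - 1)\<^sup>2 = real q * real q - 2 * real q + 1"
        by (simp add: power2_eq_square algebra_simps)
      ultimately show "real q \<le> (real q - 1)\<^sup>2" by linarith
    qed (use q in auto)
    finally have xq: "x < real q - 1" .
    then obtain \<chi> where \<chi>: "dirichlet_character q \<chi>" "\<chi> \<noteq> principal_character q"
      "(cmod (\<Sum>n | 1 \<le> n \<and> real n \<le> x. \<chi> n))\<^sup>2 \<ge> 1 / real q"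
      using nonprincipal_sum_ge_inverse[OF q x1] by blast
    have "c * L powr (e + \<epsilon> q) = c * exp (ln (1 / (c * real q)))"
      using False L by (simp add: \<epsilon>_def L_def [symmetric] powr_def)
    also have "\<dots> = 1 / real q" using c q by (subst exp_ln) auto
    also have "\<dots> = 1 / sqrt (real q) * (1 / sqrt (real q))" using q by simp
    also have "\<dots> \<le> 1 / sqrt x * cmod (\<Sum>n | 1 \<le> n \<and> real n \<le> x. \<chi> n)"
    proof (intro mult_mono)
      have "x \<le> real q" using xq by simp
      then show "1 / sqrt (real q) \<le> 1 / sqrt x" using x1 by (intro frac_le) auto
      have "sqrt (1 / real q) \<le> cmod (\<Sum>n | 1 \<le> n \<and> real n \<le> x. \<chi> n)"
        using \<chi>(3) by (intro real_le_lsqrt) auto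
      then show "1 / sqrt (real q) \<le> cmod (\<Sum>n | 1 \<le> n \<and> real n \<le> x. \<chi> n)"
        by (simp add: real_sqrt_divide)
    qed (use x1 in auto)
    finally show ?thesis using \<chi> by (auto simp: L_def)
  qed
  ultimately show ?thesis using c unfolding e_def by blast
qed

end
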